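(* Let $\theta$ be an inner function on $\mathbb{D}^2$ and let $(K_1,K_2)$ be Agler kernels of $\theta$. Then the Agler subspaces $$\mathcal{S}_1=\mathcal{H}\left(\frac{K_1(z,w)}{1-z_1\bar w_1}\right)\quad\text{and}\quad\mathcal{S}_2=\mathcal{H}\left(\frac{K_2(z,w)}{1-z_2\bar w_2}\right)$$ are reducing subspaces for $S_{z_1}$ if and only if they are subspaces of $\mathcal{K}_\theta$ and $K_1(z,w)$ is a function of only $z_2$ and $\bar w_2$. The analogous statement holds for $S_{z_2}$: $\mathcal{S}_1$ and $\mathcal{S}_2$ are reducing subspaces for $S_{z_2}$ if and only if they are subspaces of $\mathcal{K}_\theta$ and $K_2(z,w)$ is a function of only $z_1$ and $\bar w_1$.
   Context: $H^2(\mathbb{D}^2)$ is the Hardy space on the bidisk with variables $z=(z_1,z_2)$. An inner function on $\mathbb{D}^2$ is a bounded holomorphic function whose radial boundary values are unimodular a.e. on $\mathbb{T}^2$. For $\theta$ inner, $\mathcal{K}_\theta = H^2(\mathbb{D}^2)\ominus\theta H^2(\mathbb{D}^2)$, $P_\theta$ is the orthogonal projection onto $\mathcal{K}_\theta$, $T_{z_j}$ is multiplication by $z_j$ on $H^2(\mathbb{D}^2)$, and $S_{z_j}=P_\theta T_{z_j}|_{\mathcal{K}_\theta}$ for $j=1,2$. A pair of Agler kernels of $\theta$ is a pair $(K_1,K_2)$ of positive (semidefinite) kernels $K_1,K_2:\mathbb{D}^2\times\mathbb{D}^2\to\mathbb{C}$ such that $$1-\theta(z)\overline{\theta(w)} =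 (1-z_1\bar w_1)K_2(z,w)+(1-z_2\bar w_2)K_1(z,w)\qquad(z,w\in\mathbb{D}^2).$$ $\mathcal{H}(K)$ denotes the reproducing kernel Hilbert space with reproducing kernel $K$. Such a Hilbert space is called a subspace of $\mathcal{K}_\theta$ if it is a closed subspace of $\mathcal{K}_\theta$ with the norm inherited from $\mathcal{K}_\theta$; it is a reducing subspace for $S_{z_j}$ if it is a subspace of $\mathcal{K}_\theta$ in this sense and is invariant under both $S_{z_j}$ and $S_{z_j}^*$. *)

theory Defs
  imports "HOL-Analysis.Analysis"
begin

section \<open>Hilbert spaces of complex-valued functions\<close>

text \<open>
  A function on a set \<open>X\<close> is represented by its extension by zero to the whole type, so that
  equality of functions on \<open>X\<close> is HOL equality and vector operations are pointwise.
  Inner products are linear in the first argument; their values outside \<open>elems\<close> are irrelevant.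
\<close>

record 'x fun_space =
  elems :: "('x \<Rightarrow> complex) set"
  inprod :: "('x \<Rightarrow> complex) \<Rightarrow> ('x \<Rightarrow> complex) \<Rightarrow> complex"

definition hnorm :: "'x fun_space \<Rightarrow> ('x \<Rightarrow> complex) \<Rightarrow> real" where
  "hnorm H f = sqrt (Re (inprod H f f))"

definition linear_subspace :: "('x \<Rightarrow> complex) set \<Rightarrow> bool" where
  "linear_subspace V \<longleftrightarrow>
     (\<lambda>_. 0) \<in> V \<and>
     (\<forall>f\<in>V. \<forall>g\<in>V. (\<lambda>x. f x + g x) \<in> V) \<and>
     (\<forall>c. \<forall>f\<in>V. (\<lambda>x. c * f x) \<in> V)"

locale function_hilbert_space =
  fixes X :: "'x set" and H :: "'x fun_space"
  assumes zero_outside: "f \<in> elems H \<Longrightarrow> x \<notin> X \<Longrightarrow> f x = 0"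
    and linear: "linear_subspace (elems H)"
    and inprod_add: "f \<in> elems H \<Longrightarrow> g \<in> elems H \<Longrightarrow> h \<in> elems H \<Longrightarrow>
          inprod H (\<lambda>x. f x + g x) h = inprod H f h + inprod H g h"
    and inprod_scale: "f \<in> elems H \<Longrightarrow> g \<in> elems H \<Longrightarrow>
          inprod H (\<lambda>x. c * f x) g = c * inprod H f g"
    and inprod_cnj: "f \<in> elems H \<Longrightarrow> g \<in> elems H \<Longrightarrow> inprod H g f = cnj (inprod H f g)"
    and inprod_nonneg: "f \<in> elems H \<Longrightarrow> inprod H f f \<in> \<real>\<^sub>\<ge>\<^sub>0"
    and inprod_definite: "f \<in> elems H \<Longrightarrow> inprod H f f = 0 \<Longrightarrow> f = (\<lambda>_. 0)"
    and complete: "(\<And>n. F n \<in> elems H) \<Longrightarrow>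
          (\<And>e. e > 0 \<Longrightarrow> \<exists>N::nat. \<forall>m\<ge>N. \<forall>n\<ge>N. hnorm H (\<lambda>x. F m x - F n x) < e) \<Longrightarrow>
          \<exists>f\<in>elems H. (\<lambda>n. hnorm H (\<lambda>x. F n x - f x)) \<longlonglongrightarrow> 0"

definition kernel_section :: "'x set \<Rightarrow> ('x \<Rightarrow> 'x \<Rightarrow> complex) \<Rightarrow> 'x \<Rightarrow> 'x \<Rightarrow> complex" where
  "kernel_section X K w = (\<lambda>z. if z \<in> X then K z w else 0)"

text \<open>
  \<open>rkhs X H K\<close> says that \<open>H\<close> is the Hilbert space of functions on \<open>X\<close> with reproducing kernel
  \<open>K\<close>.  By the Moore--Aronszajn theorem such an \<open>H\<close> exists for every positive kernel and is
  unique (up to the irrelevant values of \<open>inprod H\<close> outside \<open>elems H\<close>).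
\<close>

locale rkhs = function_hilbert_space X H
  for X :: "'x set" and H :: "'x fun_space" +
  fixes K :: "'x \<Rightarrow> 'x \<Rightarrow> complex"
  assumes section_mem: "w \<in> X \<Longrightarrow> kernel_section X K w \<in> elems H"
    and reproducing: "f \<in> elems H \<Longrightarrow> w \<in> X \<Longrightarrow> f w = inprod H f (kernel_section X K w)"

definition positive_kernel :: "'x set \<Rightarrow> ('x \<Rightarrow> 'x \<Rightarrow> complex) \<Rightarrow> bool" where
  "positive_kernel X K \<longleftrightarrow>
     (\<forall>A c. finite A \<and> A \<subseteq> X \<longrightarrow>
        (\<Sum>z\<in>A. \<Sum>w\<in>A. c z * cnj (c w) * K z w) \<in> \<real>\<^sub>\<ge>\<^sub>0)"

text \<open>\<open>N\<close> is a closed subspace of \<open>M\<close> carrying the norm inherited from \<open>M\<close>.\<close>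

definition closed_subspace_of :: "'x fun_space \<Rightarrow> 'x fun_space \<Rightarrow> bool" where
  "closed_subspace_of N M \<longleftrightarrow>
     elems N \<subseteq> elems M \<and> linear_subspace (elems N) \<and>
     (\<forall>F f. (\<forall>n::nat. F n \<in> elems N) \<and> f \<in> elems M \<and>
            (\<lambda>n. hnorm M (\<lambda>x. F n x - f x)) \<longlonglongrightarrow> 0 \<longrightarrow> f \<in> elems N) \<and>
     (\<forall>f\<in>elems N. hnorm N f = hnorm M f)"

definition orth_complement :: "'x fun_space \<Rightarrow> ('x \<Rightarrow> complex) set \<Rightarrow> 'x fun_space" where
  "orth_complement H V = H\<lparr>elems := {f \<in> elems H. \<forall>g\<in>V. inprod H f g = 0}\<rparr>"

definition orth_projection ::
    "'x fun_space \<Rightarrow> 'x fun_space \<Rightarrow> ('x \<Rightarrow> complex) \<Rightarrow> 'x \<Rightarrow> complex" where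
  "orth_projection H M f =
     (THE g. g \<in> elems M \<and> (\<forall>h\<in>elems M. inprod H (\<lambda>x. f x - g x) h = 0))"

definition hadjoint ::
    "'x fun_space \<Rightarrow> (('x \<Rightarrow> complex) \<Rightarrow> 'x \<Rightarrow> complex) \<Rightarrow> ('x \<Rightarrow> complex) \<Rightarrow> 'x \<Rightarrow> complex" where
  "hadjoint M A g = (THE h. h \<in> elems M \<and> (\<forall>f\<in>elems M. inprod M (A f) g = inprod M f h))"

definition reducing_subspace ::
    "'x fun_space \<Rightarrow> (('x \<Rightarrow> complex) \<Rightarrow> 'x \<Rightarrow> complex) \<Rightarrow> 'x fun_space \<Rightarrow> bool" where
  "reducing_subspace M A N \<longleftrightarrow>
     closed_subspace_of N M \<and>
     (\<forall>f\<in>elems N. A f \<in> elems N) \<and>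
     (\<forall>f\<in>elems N. hadjoint M A f \<in> elems N)"


section \<open>The Hardy space of the bidisk\<close>

definition bidisk :: "(complex \<times> complex) set" where
  "bidisk = ball 0 1 \<times> ball 0 1"

definition power_series2 :: "(complex \<times> complex \<Rightarrow> complex) \<Rightarrow> (nat \<times> nat \<Rightarrow> complex) \<Rightarrow> bool" where
  "power_series2 f a \<longleftrightarrow>
     (\<forall>z\<in>bidisk. ((\<lambda>(m, n). a (m, n) * fst z ^ m * snd z ^ n) has_sum f z) UNIV)"

definition coeffs2 :: "(complex \<times> complex \<Rightarrow> complex) \<Rightarrow> nat \<times> nat \<Rightarrow> complex" where
  "coeffs2 f = (THE a. power_series2 f a)"

text \<open>The Hardy space in its description by square-summable Taylor coefficients.\<close>

definition hardy2 :: "(complex \<times> complex) fun_space" where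
  "hardy2 = \<lparr>elems = {f. (\<forall>z. z \<notin> bidisk \<longrightarrow> f z = 0) \<and>
                 (\<exists>a. power_series2 f a \<and> (\<lambda>p. (cmod (a p))\<^sup>2) summable_on UNIV)},
             inprod = (\<lambda>f g. \<Sum>\<^sub>\<infinity>p. coeffs2 f p * cnj (coeffs2 g p))\<rparr>"

definition holomorphic2_on :: "(complex \<times> complex \<Rightarrow> complex) \<Rightarrow> (complex \<times> complex) set \<Rightarrow> bool" where
  "holomorphic2_on f S \<longleftrightarrow>
     (\<forall>z\<in>S. \<exists>a b. (f has_derivative (\<lambda>h. a * fst h + b * snd h)) (at z within S))"

text \<open>The torus is parametrised by \<open>[0, 2\<pi>)\<^sup>2\<close> with two-dimensional Lebesgue measure.\<close>

definition inner_function :: "(complex \<times> complex \<Rightarrow> complex) \<Rightarrow> bool" where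
  "inner_function \<theta> \<longleftrightarrow>
     holomorphic2_on \<theta> bidisk \<and> bounded (\<theta> ` bidisk) \<and>
     (AE t\<in>{0..<2*pi} \<times> {0..<2*pi} in lborel.
        \<exists>l. ((\<lambda>r. \<theta> (of_real r * cis (fst t), of_real r * cis (snd t))) \<longlongrightarrow> l) (at_left (1::real))
            \<and> cmod l = 1)"

definition model_space :: "(complex \<times> complex \<Rightarrow> complex) \<Rightarrow> (complex \<times> complex) fun_space" where
  "model_space \<theta> = orth_complement hardy2 ((\<lambda>g z. \<theta> z * g z) ` elems hardy2)"

text \<open>
  For a multiplier \<open>\<phi>\<close>, the compression of multiplication by \<open>\<phi>\<close> to the model space.  The
  coordinate functions are \<open>fst\<close> and \<open>snd\<close>, so the compressed shifts $S_{z_1}$, $S_{z_2}$ are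
  \<open>compression \<theta> fst\<close> and \<open>compression \<theta> snd\<close>.
\<close>

definition compression ::
    "(complex \<times> complex \<Rightarrow> complex) \<Rightarrow> (complex \<times> complex \<Rightarrow> complex) \<Rightarrow>
     (complex \<times> complex \<Rightarrow> complex) \<Rightarrow> complex \<times> complex \<Rightarrow> complex" where
  "compression \<theta> \<phi> f = orth_projection hardy2 (model_space \<theta>) (\<lambda>z. \<phi> z * f z)"

text \<open>Note the crossed indices: \<open>K2\<close> goes with the first variable, \<open>K1\<close> with the second.\<close>

definition agler_kernels ::
    "(complex \<times> complex \<Rightarrow> complex) \<Rightarrow>
     (complex \<times> complex \<Rightarrow> complex \<times> complex \<Rightarrow> complex) \<Rightarrow>
     (complex \<times> complex \<Rightarrow> complex \<times> complex \<Rightarrow> complex) \<Rightarrow> bool" where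
  "agler_kernels \<theta> K1 K2 \<longleftrightarrow>
     positive_kernel bidisk K1 \<and> positive_kernel bidisk K2 \<and>
     (\<forall>z\<in>bidisk. \<forall>w\<in>bidisk.
        1 - \<theta> z * cnj (\<theta> w) =
          (1 - fst z * cnj (fst w)) * K2 z w + (1 - snd z * cnj (snd w)) * K1 z w)"

end

theory Submission
  imports Defs
begin

text \<open>
  Both statements are instances of one about a backward shift \<open>B\<close>, the adjoint of multiplication by
  one of the variables \<open>\<zeta>\<close>, with \<open>\<rho>\<close> the map that sets this variable to 0, so that
  \<open>\<zeta> B f = f - f \<circ> \<rho>\<close>.  On the model space the adjoint of the compressed shift \<open>A\<close> is \<open>B\<close>.

  If \<open>S1\<close> reduces \<open>A\<close>, then its kernel functions satisfy \<open>cnj (\<zeta> w) A k\<^sub>w = k\<^sub>w - k\<^bsub>\<rho> w\<^esub>\<close>.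
  Comparing norms and using that \<open>K1\<close> is a positive kernel, \<open>cnj (\<zeta> w) \<zeta> k\<^sub>w\<close> lies in the model
  space and is equal to \<open>cnj (\<zeta> w) A k\<^sub>w\<close>, which says \<open>K1 z w = K1 z (\<rho> w)\<close>.

  Conversely, this identity makes the orthogonal complement of \<open>S1\<close> invariant under \<open>\<zeta>\<close> and \<open>B\<close>,
  hence so is \<open>S1\<close>; and \<open>S2\<close> is the orthogonal complement of \<open>S1\<close> in the model space, because the
  two kernels sum to the reproducing kernel of the model space.  Positivity of this sum is also what
  makes \<open>\<theta>\<close> a multiplier of the Hardy space.
\<close>

section \<open>Hilbert spaces of functions\<close>

lemma linear_subspace_diff:
  assumes "linear_subspace V" "f \<in> V" "g \<in> V"
  shows "(\<lambda>x. f x - g x) \<in> V"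
proof -
  have "(\<lambda>x. (-1) * g x) \<in> V"
    using assms unfolding linear_subspace_def by fast
  then have "(\<lambda>x. f x + (-1) * g x) \<in> V"
    using assms unfolding linear_subspace_def by fast
  then show ?thesis by simp
qed

context function_hilbert_space
begin

abbreviation ip where "ip \<equiv> inprod H"
abbreviation nrm where "nrm \<equiv> hnorm H"

lemma zero_mem: "(\<lambda>_. 0) \<in> elems H"
  and add_mem: "f \<in> elems H \<Longrightarrow> g \<in> elems H \<Longrightarrow> (\<lambda>x. f x + g x) \<in> elems H"
  and scale_mem: "f \<in> elems H \<Longrightarrow> (\<lambda>x. c * f x) \<in> elems H"
  using linear by (auto simp: linear_subspace_def)

lemma diff_mem: "f \<in> elems H \<Longrightarrow> g \<in> elems H \<Longrightarrow> (\<lambda>x. f x - g x) \<in> elems H"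
  by (rule linear_subspace_diff[OF linear])

lemma ip_add_right:
  assumes "f \<in> elems H" "g \<in> elems H" "h \<in> elems H"
  shows "ip h (\<lambda>x. f x + g x) = ip h f + ip h g"
  using assms inprod_add[of f g h]
  by (simp add: inprod_cnj[of "\<lambda>x. f x + g x" h] inprod_cnj[of f h] inprod_cnj[of g h] add_mem)

lemma ip_scale_right:
  assumes "f \<in> elems H" "h \<in> elems H"
  shows "ip h (\<lambda>x. c * f x) = cnj c * ip h f"
  using assms inprod_scale[of f h c]
  by (simp add: inprod_cnj[of "\<lambda>x. c * f x" h] inprod_cnj[of f h] scale_mem)

lemma ip_diff_left:
  assumes "f \<in> elems H" "g \<in> elems H" "h \<in> elems H"
  shows "ip (\<lambda>x. f x - g x) h = ip f h - ip g h"
  using assms inprod_add[of f "\<lambda>x. -1 * g x" h] inprod_scale[of g h "-1"] scale_mem[of g "-1"]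
  by simp

lemma ip_diff_right:
  assumes "f \<in> elems H" "g \<in> elems H" "h \<in> elems H"
  shows "ip h (\<lambda>x. f x - g x) = ip h f - ip h g"
  using assms ip_diff_left[of f g h]
  by (simp add: inprod_cnj[of "\<lambda>x. f x - g x" h] inprod_cnj[of f h] inprod_cnj[of g h] diff_mem)

lemma ip_zero_left: "h \<in> elems H \<Longrightarrow> ip (\<lambda>_. 0) h = 0"
  using inprod_scale[of "\<lambda>_. 0" h 0] zero_mem by simp

lemma ip_zero_right: "h \<in> elems H \<Longrightarrow> ip h (\<lambda>_. 0) = 0"
  using ip_scale_right[of "\<lambda>_. 0" h 0] zero_mem by simp

lemma ip_self:
  assumes "f \<in> elems H"
  shows "ip f f = of_real ((nrm f)\<^sup>2)"
proof -
  obtain r where "ip f f = of_real r" "r \<ge> 0"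
    using inprod_nonneg[OF assms] by (elim nonneg_Reals_cases)
  then show ?thesis by (simp add: hnorm_def flip: of_real_power)
qed

lemma nrm_nonneg: "f \<in> elems H \<Longrightarrow> nrm f \<ge> 0"
  using inprod_nonneg[of f] unfolding hnorm_def by (auto elim!: nonneg_Reals_cases)

lemma nrm_eq_0: "f \<in> elems H \<Longrightarrow> nrm f = 0 \<Longrightarrow> f = (\<lambda>_. 0)"
  using inprod_definite ip_self by simp

lemma nrm_sq_add_scaled:
  assumes "f \<in> elems H" "g \<in> elems H"
  shows "(nrm (\<lambda>x. f x + c * g x))\<^sup>2 = (nrm f)\<^sup>2 + 2 * Re (c * ip g f) + (cmod c)\<^sup>2 * (nrm g)\<^sup>2"
proof -
  have "of_real ((nrm (\<lambda>x. f x + c * g x))\<^sup>2)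
      = ip f f + (c * ip g f + cnj (c * ip g f)) + c * cnj c * ip g g"
    using assms inprod_cnj[of g f]
    by (simp only: ip_self[symmetric] add_mem scale_mem inprod_add ip_add_right inprod_scale
        ip_scale_right complex_cnj_mult ring_distribs ac_simps)
  also have "\<dots> = of_real ((nrm f)\<^sup>2 + 2 * Re (c * ip g f) + (cmod c)\<^sup>2 * (nrm g)\<^sup>2)"
    using assms by (simp add: ip_self complex_add_cnj complex_norm_square[symmetric] del: complex_cnj_mult times_complex.simps)
  finally show ?thesis
    using of_real_eq_iff by blast
qed

lemma nrm_sq_diff:
  assumes "f \<in> elems H" "g \<in> elems H"
  shows "(nrm (\<lambda>x. f x - g x))\<^sup>2 = (nrm f)\<^sup>2 - 2 * Re (ip g f) + (nrm g)\<^sup>2"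
  using nrm_sq_add_scaled[OF assms, of "-1"] by simp

lemma nrm_scale:
  assumes "f \<in> elems H"
  shows "nrm (\<lambda>x. c * f x) = cmod c * nrm f"
proof -
  have "(nrm (\<lambda>x. c * f x))\<^sup>2 = (cmod c * nrm f)\<^sup>2"
    using nrm_sq_add_scaled[OF zero_mem assms, of c] zero_mem assms
    by (simp add: ip_zero_right power_mult_distrib hnorm_def)
  then show ?thesis
    using assms by (simp add: nrm_nonneg scale_mem)
qed

text \<open>The choice t = - cnj d / (q + e) nearly minimises the left side. The slack
  \<open>e\<close> keeps the denominator positive when \<open>q\<close> is 0; Cauchy-Schwarz makes
  it arbitrarily small, the Riesz argument takes it to be 1.\<close>

lemma discriminant:
  assumes "\<And>t::complex. 2 * Re (t * d) + (cmod t)\<^sup>2 * q \<ge> - b" and "q \<ge> 0" "e > 0"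
  shows "(cmod d)\<^sup>2 \<le> b * (q + e)"
proof -
  define s where "s = 1 / (q + e)"
  have pos: "q + e > 0" using assms by simp
  define t where "t = - (of_real s * cnj d)"
  have "t * d = - of_real (s * (cmod d)\<^sup>2)"
    by (simp add: t_def complex_norm_square mult_ac del: of_real_power)
  then have "Re (t * d) = - (s * (cmod d)\<^sup>2)"
    by (simp only: Re_complex_of_real uminus_complex.simps)
  moreover have "(cmod t)\<^sup>2 = s\<^sup>2 * (cmod d)\<^sup>2"
    by (simp add: t_def norm_mult power_mult_distrib)
  ultimately have "- b \<le> - (2 * (s * (cmod d)\<^sup>2)) + s\<^sup>2 * (cmod d)\<^sup>2 * q"
    using assms(1)[of t] by simp
  also have "\<dots> = (cmod d)\<^sup>2 * (- 2 * s + s\<^sup>2 * q)"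
    by (simp add: algebra_simps)
  finally have *: "- b \<le> (cmod d)\<^sup>2 * (- 2 * s + s\<^sup>2 * q)" .
  have "s * (s * q) \<le> s * 1"
    using pos assms(2,3) by (intro mult_left_mono) (simp_all add: s_def)
  then have "s\<^sup>2 * q \<le> s" by (simp add: power2_eq_square mult.assoc)
  then have "(cmod d)\<^sup>2 * (- 2 * s + s\<^sup>2 * q) \<le> (cmod d)\<^sup>2 * (- s)"
    by (intro mult_left_mono) auto
  with * have "(cmod d)\<^sup>2 * s \<le> b" by simp
  then show ?thesis using pos by (simp add: s_def field_simps)
qed

text \<open>The squared norm of f + t g is nonnegative for every complex t, so
  \<open>discriminant\<close> bounds the inner product.\<close>

lemma cauchy_schwarz:
  assumes f: "f \<in> elems H" and g: "g \<in> elems H"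
  shows "cmod (ip g f) \<le> nrm g * nrm f"
proof -
  have "2 * Re (t * ip g f) + (cmod t)\<^sup>2 * (nrm g)\<^sup>2 \<ge> - (nrm f)\<^sup>2" for t
    using zero_le_power2[of "nrm (\<lambda>x. f x + t * g x)"]
    unfolding nrm_sq_add_scaled[OF assms] by simp
  note e = discriminant[OF this zero_le_power2]
  have "(cmod (ip g f))\<^sup>2 \<le> (nrm f * nrm g)\<^sup>2"
  proof (rule field_le_epsilon)
    fix e :: real assume "e > 0"
    \<comment> \<open>The slack is \<open>e\<close> divided by the squared norm of \<open>f\<close>
      plus 1, so that it adds at most \<open>e\<close> to the bound.\<close>
    have "(nrm f)\<^sup>2 * (e / ((nrm f)\<^sup>2 + 1)) = e * ((nrm f)\<^sup>2 / ((nrm f)\<^sup>2 + 1))"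
      by simp
    also have "\<dots> \<le> e * 1"
      using \<open>e > 0\<close> by (intro mult_left_mono) (auto simp: divide_le_eq add_nonneg_pos)
    finally have "(nrm f)\<^sup>2 * (e / ((nrm f)\<^sup>2 + 1)) \<le> e" by simp
    moreover have "e / ((nrm f)\<^sup>2 + 1) > 0"
      using \<open>e > 0\<close> by (simp add: add_nonneg_pos)
    note e[OF this]
    ultimately show "(cmod (ip g f))\<^sup>2 \<le> (nrm f * nrm g)\<^sup>2 + e"
      by (simp add: power_mult_distrib distrib_left)
  qed
  then have "cmod (ip g f) \<le> nrm f * nrm g"
    by (rule power2_le_imp_le) (simp add: f g nrm_nonneg)
  then show ?thesis by (simp add: mult.commute)
qed

lemma ip_tendsto_right:
  assumes F: "\<And>n::nat. F n \<in> elems H" and g: "g \<in> elems H" and v: "v \<in> elems H"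
    and lim: "(\<lambda>n. nrm (\<lambda>x. F n x - g x)) \<longlonglongrightarrow> 0"
  shows "(\<lambda>n. ip v (F n)) \<longlonglongrightarrow> ip v g"
proof -
  have "(\<lambda>n. nrm v * nrm (\<lambda>x. F n x - g x)) \<longlonglongrightarrow> 0"
    using tendsto_mult_left[OF lim, of "nrm v"] by simp
  moreover have "cmod (ip v (F n) - ip v g) \<le> nrm v * nrm (\<lambda>x. F n x - g x)" for n
    using cauchy_schwarz[OF diff_mem[OF F g] v] unfolding ip_diff_right[OF F g v] .
  ultimately have "(\<lambda>n. ip v (F n) - ip v g) \<longlonglongrightarrow> 0"
    by - (rule Lim_null_comparison[of "\<lambda>n. ip v (F n) - ip v g" "\<lambda>n. nrm v * nrm (\<lambda>x. F n x - g x)"], simp)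
  then show ?thesis by (rule LIM_zero_cancel)
qed

text \<open>A bounded functional on a subspace is given as a relation \<open>G\<close>, so that it need not be known
  to be single-valued.  The representing vector minimises \<open>\<parallel>u\<parallel>\<^sup>2 - 2 Re a\<close> over \<open>(u, a) \<in> G\<close>.\<close>

lemma riesz_relation:
  assumes G: "fst ` G \<subseteq> elems H" and zero: "((\<lambda>_. 0), 0) \<in> G"
    and add: "\<And>u a v b. (u, a) \<in> G \<Longrightarrow> (v, b) \<in> G \<Longrightarrow> ((\<lambda>x. u x + v x), a + b) \<in> G"
    and scale: "\<And>u a c. (u, a) \<in> G \<Longrightarrow> ((\<lambda>x. c * u x), c * a) \<in> G"
    and bound: "\<And>u a. (u, a) \<in> G \<Longrightarrow> cmod a \<le> C * nrm u"
  obtains g F where "g \<in> elems H" "\<And>u a. (u, a) \<in> G \<Longrightarrow> ip u g = a"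
    "\<And>n::nat. F n \<in> fst ` G" "(\<lambda>n. nrm (\<lambda>x. F n x - g x)) \<longlonglongrightarrow> 0"
proof -
  define J where "J = (\<lambda>(u, a). (nrm u)\<^sup>2 - 2 * Re a)"
  have mem: "u \<in> elems H" if "(u, a) \<in> G" for u a
    using that G by force
  have lower: "- C\<^sup>2 \<le> J p" if "p \<in> G" for p
  proof -
    obtain u a where p: "p = (u, a)" by (cases p)
    have "0 \<le> (nrm u - C)\<^sup>2" by simp
    moreover have "Re a \<le> C * nrm u"
      using bound that p complex_Re_le_cmod order_trans by blast
    ultimately show ?thesis
      by (simp add: J_def p power2_diff algebra_simps)
  qed
  then have bdd: "bdd_below (J ` G)" by (meson bdd_below.I2)
  define m where "m = Inf (J ` G)"
  have m_le: "m \<le> J p" if "p \<in> G" for p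
    unfolding m_def using bdd that by (rule cINF_lower)
  have "\<exists>p\<in>G. J p < m + 1 / real (Suc n)" for n
    using cInf_lessD[of "J ` G" "m + 1 / real (Suc n)"] zero unfolding m_def by fastforce
  then have "\<forall>n. \<exists>p. p \<in> G \<and> J p < m + 1 / real (Suc n)" by blast
  then obtain p where "\<forall>n. p n \<in> G \<and> J (p n) < m + 1 / real (Suc n)"
    by (rule choice[THEN exE])
  then have pG: "\<And>n. p n \<in> G" and pJ: "\<And>n. J (p n) < m + 1 / real (Suc n)"
    by simp_all
  define F where "F n = fst (p n)" for n
  define c where "c n = snd (p n)" for n
  have FG: "(F n, c n) \<in> G" and FJ: "J (F n, c n) < m + 1 / real (Suc n)" for n
    using pG pJ by (simp_all add: F_def c_def)
  have Fmem: "F n \<in> elems H" for n using FG mem by blast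
  \<comment> \<open>The midpoint of the two pairs lies in \<open>G\<close>, so \<open>m\<close>
    bounds its \<open>J\<close> from below. With the parallelogram law this forces near-minimisers
    of \<open>J\<close> to be close to each other.\<close>
  have parallelogram: "(nrm (\<lambda>x. u x - v x))\<^sup>2 \<le> 2 * (J (u, a) - m) + 2 * (J (v, b) - m)"
    if uG: "(u, a) \<in> G" and vG: "(v, b) \<in> G" for u a v b
  proof -
    have "((\<lambda>x. (1/2) * (u x + v x)), (1/2) * (a + b)) \<in> G"
      by (intro scale add uG vG)
    from m_le[OF this]
    have "m \<le> (nrm (\<lambda>x. (1/2) * (u x + v x)))\<^sup>2 - Re (a + b)"
      unfolding J_def by simp (simp add: field_simps)
    also have "(nrm (\<lambda>x. (1/2) * (u x + v x)))\<^sup>2 = (nrm (\<lambda>x. u x + 1 * v x))\<^sup>2 / 4"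
      unfolding nrm_scale[OF add_mem[OF mem[OF uG] mem[OF vG]], of "1/2"]
      by (simp add: power_divide)
    also have "\<dots> = ((nrm u)\<^sup>2 + 2 * Re (ip v u) + (nrm v)\<^sup>2) / 4"
      using nrm_sq_add_scaled[OF mem[OF uG] mem[OF vG], of 1] by simp
    finally show ?thesis
      unfolding J_def nrm_sq_diff[OF mem[OF uG] mem[OF vG]] by (simp add: field_simps)
  qed
  have gap: "(nrm (\<lambda>x. F k x - F l x))\<^sup>2 \<le> 4 / real (Suc N)" if "k \<ge> N" "l \<ge> N" for k l N
  proof -
    have "1 / real (Suc k) \<le> 1 / real (Suc N)" "1 / real (Suc l) \<le> 1 / real (Suc N)"
      using that by (auto simp: field_simps)
    then have "J (F k, c k) - m \<le> 1 / real (Suc N)" "J (F l, c l) - m \<le> 1 / real (Suc N)"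
      using FJ[of k] FJ[of l] by linarith+
    then have "2 * (J (F k, c k) - m) + 2 * (J (F l, c l) - m) \<le> 4 * (1 / real (Suc N))"
      by (smt (verit))
    with parallelogram[OF FG[of k] FG[of l]] show ?thesis
      by simp
  qed
  have "\<exists>g\<in>elems H. (\<lambda>n. nrm (\<lambda>x. F n x - g x)) \<longlonglongrightarrow> 0"
  proof (rule complete[OF Fmem])
    fix e :: real assume "e > 0"
    then obtain N where N: "1 / real (Suc N) < e\<^sup>2 / 4"
      using nat_approx_posE[of "e\<^sup>2 / 4"] by auto
    have "nrm (\<lambda>x. F k x - F l x) < e" if "k \<ge> N" "l \<ge> N" for k l
    proof -
      have "(nrm (\<lambda>x. F k x - F l x))\<^sup>2 < e\<^sup>2"
        using gap[OF that] N by simp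
      then show ?thesis using \<open>e > 0\<close> power2_less_imp_less by fastforce
    qed
    then show "\<exists>N. \<forall>k\<ge>N. \<forall>l\<ge>N. nrm (\<lambda>x. F k x - F l x) < e" by blast
  qed
  then obtain g where g: "g \<in> elems H" and lim: "(\<lambda>n. nrm (\<lambda>x. F n x - g x)) \<longlonglongrightarrow> 0"
    by blast
  have rep: "ip v g = b" if vG: "(v, b) \<in> G" for v b
  proof -
    have v: "v \<in> elems H" using vG mem by blast
    \<comment> \<open>\<open>F n\<close> is within 1 / (n + 1) of the infimum, so adding a multiple
      of \<open>v\<close> lowers \<open>J\<close> by less than that. \<open>discriminant\<close>
      with slack 1 turns this into a bound on the first-order term.\<close>
    have near: "(cmod (ip v (F n) - b))\<^sup>2 \<le> 1 / real (Suc n) * ((nrm v)\<^sup>2 + 1)" for n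
    proof (rule discriminant)
      fix t
      have "m \<le> J ((\<lambda>x. F n x + t * v x), c n + t * b)"
        by (intro m_le add scale FG vG)
      also have "\<dots> = J (F n, c n) + 2 * Re (t * (ip v (F n) - b)) + (cmod t)\<^sup>2 * (nrm v)\<^sup>2"
        using nrm_sq_add_scaled[OF Fmem v] by (simp add: J_def algebra_simps)
      finally show "- (1 / real (Suc n)) \<le> 2 * Re (t * (ip v (F n) - b)) + (cmod t)\<^sup>2 * (nrm v)\<^sup>2"
        using FJ[of n] by linarith
    qed auto
    have lim0: "(\<lambda>n. 1 / real (Suc n) * ((nrm v)\<^sup>2 + 1)) \<longlonglongrightarrow> 0"
      using tendsto_mult_right[OF LIMSEQ_Suc[OF lim_1_over_n], of "(nrm v)\<^sup>2 + 1"]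
      by (simp only: mult_zero_left)
    have "(\<lambda>n. (cmod (ip v (F n) - b))\<^sup>2) \<longlonglongrightarrow> 0"
      by (rule tendsto_sandwich[OF always_eventually always_eventually tendsto_const lim0])
        (intro allI zero_le_power2 near)+
    from tendsto_real_sqrt[OF this] have "(\<lambda>n. cmod (ip v (F n) - b)) \<longlonglongrightarrow> 0"
      by (simp only: real_sqrt_abs abs_norm_cancel real_sqrt_zero)
    then have 1: "(\<lambda>n. ip v (F n)) \<longlonglongrightarrow> b"
      by (rule LIM_zero_cancel[OF tendsto_norm_zero_cancel])
    have "(\<lambda>n. ip v (F n)) \<longlonglongrightarrow> ip v g"
      by (rule ip_tendsto_right[OF Fmem g v lim])
    with 1 show ?thesis by (simp add: LIMSEQ_unique)
  qed
  show ?thesis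
    by (rule that[OF g rep _ lim]) (use FG in \<open>force+\<close>)
qed

lemma riesz:
  assumes \<phi>_add: "\<And>u v. u \<in> elems H \<Longrightarrow> v \<in> elems H \<Longrightarrow> \<phi> (\<lambda>x. u x + v x) = \<phi> u + \<phi> v"
    and \<phi>_scale: "\<And>u c. u \<in> elems H \<Longrightarrow> \<phi> (\<lambda>x. c * u x) = c * \<phi> u"
    and \<phi>_bound: "\<And>u. u \<in> elems H \<Longrightarrow> cmod (\<phi> u) \<le> C * nrm u"
  obtains g where "g \<in> elems H" "\<And>u. u \<in> elems H \<Longrightarrow> ip u g = \<phi> u"
proof (rule riesz_relation[of "(\<lambda>u. (u, \<phi> u)) ` elems H" C])
  show "(\<lambda>_. 0, 0) \<in> (\<lambda>u. (u, \<phi> u)) ` elems H"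
    using \<phi>_scale[OF zero_mem, of 0] zero_mem by (simp add: image_iff)
  fix g assume "g \<in> elems H" "\<And>u a. (u, a) \<in> (\<lambda>u. (u, \<phi> u)) ` elems H \<Longrightarrow> ip u g = a"
  then show thesis by (intro that) auto
qed (use \<phi>_add \<phi>_scale \<phi>_bound in \<open>auto simp: add_mem scale_mem image_iff\<close>)

section \<open>Orthogonal complements and projections\<close>

lemma complement_linear:
  assumes V: "V \<subseteq> elems H"
  shows "linear_subspace (elems (orth_complement H V))"
  unfolding linear_subspace_def
proof (intro conjI ballI allI)
  fix f g c assume "f \<in> elems (orth_complement H V)"
  then have f: "f \<in> elems H" "\<And>v. v \<in> V \<Longrightarrow> ip f v = 0"
    by (auto simp: orth_complement_def)
  then show "(\<lambda>x. c * f x) \<in> elems (orth_complement H V)"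
    using V by (auto simp: orth_complement_def scale_mem inprod_scale subset_iff)
  assume "g \<in> elems (orth_complement H V)"
  then have "g \<in> elems H" "\<And>v. v \<in> V \<Longrightarrow> ip g v = 0"
    by (auto simp: orth_complement_def)
  with f show "(\<lambda>x. f x + g x) \<in> elems (orth_complement H V)"
    using V by (auto simp: orth_complement_def add_mem inprod_add subset_iff)
qed (use V in \<open>auto simp: orth_complement_def zero_mem ip_zero_left subset_iff\<close>)

text \<open>The projection is the Riesz representative of the inner product with \<open>f\<close> on
  \<open>M\<close>. \<open>riesz_relation\<close> delivers it in \<open>H\<close>, as a limit of
  elements of \<open>M\<close>, so membership in \<open>M\<close> comes from continuity of the inner
  product. Uniqueness then identifies it with the \<open>THE\<close> of the definition.\<close>

lemma projection_on_complement:
  assumes V: "V \<subseteq> elems H" and f: "f \<in> elems H"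
  defines "M \<equiv> orth_complement H V"
  shows "orth_projection H M f \<in> elems M" (is ?mem)
    and "h \<in> elems M \<Longrightarrow> ip (\<lambda>x. f x - orth_projection H M f x) h = 0"
proof -
  have MH: "elems M \<subseteq> elems H" by (auto simp: M_def orth_complement_def)
  have lin: "linear_subspace (elems M)"
    unfolding M_def by (rule complement_linear[OF V])
  let ?G = "(\<lambda>u. (u, ip u f)) ` elems M"
  obtain g F where g: "g \<in> elems H" and gf: "\<And>u a. (u, a) \<in> ?G \<Longrightarrow> ip u g = a"
    and F: "\<And>n::nat. F n \<in> fst ` ?G" and lim: "(\<lambda>n. nrm (\<lambda>x. F n x - g x)) \<longlonglongrightarrow> 0"
  proof (rule riesz_relation[of ?G "nrm f"])
    show "cmod a \<le> nrm f * nrm u" if "(u, a) \<in> ?G" for u a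
      using that MH cauchy_schwarz[OF f, of u] by (auto simp: mult.commute)
    show "((\<lambda>_. 0), 0) \<in> ?G"
      using lin f by (simp add: linear_subspace_def ip_zero_left image_iff)
    show "((\<lambda>x. u x + v x), a + b) \<in> ?G" if "(u, a) \<in> ?G" "(v, b) \<in> ?G" for u a v b
    proof -
      have "u \<in> elems M" "v \<in> elems M" "a = ip u f" "b = ip v f" using that by auto
      with lin f MH show ?thesis
        by (simp add: linear_subspace_def inprod_add subset_iff image_iff)
    qed
    show "((\<lambda>x. c * u x), c * a) \<in> ?G" if "(u, a) \<in> ?G" for u a c
    proof -
      have "u \<in> elems M" "a = ip u f" using that by auto
      with lin f MH show ?thesis
        by (simp add: linear_subspace_def inprod_scale subset_iff image_iff)
    qed
  qed (use MH in auto)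
  have FM: "F n \<in> elems M" for n using F[of n] by auto
  have "ip v g = 0" if "v \<in> V" for v
  proof -
    have v: "v \<in> elems H" using that V by blast
    have FH: "F n \<in> elems H" for n using FM MH by blast
    have "ip v (F n) = 0" for n
      using FM[of n] that inprod_cnj[OF FH[of n] v] by (simp add: M_def orth_complement_def)
    then show ?thesis
      using ip_tendsto_right[OF FH g v lim] by (simp add: LIMSEQ_const_iff)
  qed
  then have gM: "g \<in> elems M"
    using V g inprod_cnj[of _ g] by (auto simp: M_def orth_complement_def subset_iff)
  have orth: "ip (\<lambda>x. f x - g x) h = 0" if "h \<in> elems M" for h
  proof -
    have h: "h \<in> elems H" using that MH by blast
    have "ip h (\<lambda>x. f x - g x) = 0"
      using gf[of h "ip h f"] that by (simp add: ip_diff_right f g h)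
    then show ?thesis
      using inprod_cnj[OF h diff_mem[OF f g]] by simp
  qed
  have uniq: "g' = g" if g': "g' \<in> elems M" "\<forall>h\<in>elems M. ip (\<lambda>x. f x - g' x) h = 0" for g'
  proof -
    have g'H: "g' \<in> elems H" using g' MH by blast
    have d: "(\<lambda>x. g x - g' x) \<in> elems M"
      by (rule linear_subspace_diff[OF lin gM g'(1)])
    have "ip (\<lambda>x. g x - g' x) (\<lambda>x. g x - g' x) = 0"
      using g'(2)[rule_format, OF d] orth[OF d] d MH f g g'H
      by (simp add: ip_diff_left subset_iff)
    then have "(\<lambda>x. g x - g' x) = (\<lambda>_. 0)"
      using inprod_definite d MH by blast
    then show ?thesis by (auto simp: fun_eq_iff)
  qed
  have "orth_projection H M f = g"
    unfolding orth_projection_def using gM orth uniq by (intro the_equality) blast+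
  then show ?mem "h \<in> elems M \<Longrightarrow> ip (\<lambda>x. f x - orth_projection H M f x) h = 0"
    using gM orth by simp_all
qed

end

section \<open>Reproducing kernels and multipliers\<close>

context rkhs
begin

lemma eqI:
  assumes "f \<in> elems H" "g \<in> elems H" "\<And>w. w \<in> X \<Longrightarrow> f w = g w"
  shows "f = g"
  using assms zero_outside by (metis ext)

lemma ip_section_left: "f \<in> elems H \<Longrightarrow> w \<in> X \<Longrightarrow> ip (kernel_section X K w) f = cnj (f w)"
  using reproducing[of f w] inprod_cnj[OF _ section_mem[of w], of f] by simp

lemma ip_sections: "z \<in> X \<Longrightarrow> w \<in> X \<Longrightarrow> ip (kernel_section X K w) (kernel_section X K z) = K z w"
  using reproducing[OF section_mem, of w z] by (simp add: kernel_section_def)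

lemma kernel_hermitian: "z \<in> X \<Longrightarrow> w \<in> X \<Longrightarrow> K w z = cnj (K z w)"
  using inprod_cnj[OF section_mem section_mem, of w z] ip_sections by simp

text \<open>With lists, sums and scalar multiples of combinations become appending and mapping.
  Different lists may give the same function, so a functional computed from lists is at first only a
  relation, which is what \<open>riesz_relation\<close> accepts.\<close>

definition combination :: "(complex \<times> 'x) list \<Rightarrow> 'x \<Rightarrow> complex" where
  "combination xs = (\<lambda>x. \<Sum>(c, w)\<leftarrow>xs. c * kernel_section X K w x)"

lemma combination_Nil [simp]: "combination [] = (\<lambda>_. 0)"
  and combination_Cons: "combination ((c, w) # xs) = (\<lambda>x. c * kernel_section X K w x + combination xs x)"
  and combination_append: "combination (xs @ ys) = (\<lambda>x. combination xs x + combination ys x)"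
  by (simp_all add: combination_def)

lemma combination_scale: "combination (map (\<lambda>(d, w). (c * d, w)) xs) = (\<lambda>x. c * combination xs x)"
  by (induction xs) (auto simp: combination_Cons algebra_simps)

lemma combination_mem: "snd ` set xs \<subseteq> X \<Longrightarrow> combination xs \<in> elems H"
proof (induction xs)
  case (Cons p xs)
  then show ?case
    by (cases p) (simp add: combination_Cons add_mem scale_mem section_mem)
qed (simp add: zero_mem)

lemma ip_combination_left:
  assumes f: "f \<in> elems H"
  shows "snd ` set xs \<subseteq> X \<Longrightarrow> ip (combination xs) f = (\<Sum>(c, w)\<leftarrow>xs. c * cnj (f w))"
proof (induction xs)
  case (Cons p xs)
  then show ?case using f
    by (cases p) (simp add: combination_Cons inprod_add inprod_scale scale_mem section_mem
        combination_mem ip_section_left)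
qed (simp add: f ip_zero_left)

lemma nrm_sq_combination:
  assumes "snd ` set xs \<subseteq> X"
  shows "of_real ((nrm (combination xs))\<^sup>2) = (\<Sum>(c, w)\<leftarrow>xs. c * cnj (combination xs w))"
  using ip_combination_left[OF combination_mem] ip_self[OF combination_mem] assms by metis

text \<open>The left side of \<open>split\<close> is a positive kernel, being a sum of two
  reproducing kernels. Hence sending the section at w to \<open>cnj (\<theta> w)\<close> times
  itself is contractive on the span of the sections. This map is the prospective adjoint of
  multiplication by \<theta>, and Riesz representation recovers the product \<theta> f from
  it.\<close>

lemma multiplier_mem:
  assumes "rkhs X H1 K1" and "rkhs X H2 K2"
    and split: "\<And>z w. z \<in> X \<Longrightarrow> w \<in> X \<Longrightarrow> (1 - \<theta> z * cnj (\<theta> w)) * K z w = K1 z w + K2 z w"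
    and f: "f \<in> elems H"
  shows "(\<lambda>z. \<theta> z * f z) \<in> elems H"
proof -
  interpret H1: rkhs X H1 K1 by fact
  interpret H2: rkhs X H2 K2 by fact
  \<comment> \<open>\<open>twist\<close> is the prospective adjoint, acting on lists.\<close>
  define twist where "twist = map (\<lambda>(c, w). (c * cnj (\<theta> w), w))"
  have twist_X: "snd ` set (twist xs) = snd ` set xs" for xs
    by (force simp: twist_def)
  have pointwise: "combination xs w = \<theta> w * combination (twist xs) w
      + H1.combination xs w + H2.combination xs w"
    if "snd ` set xs \<subseteq> X" "w \<in> X" for xs w
    using that(1)
  proof (induction xs)
    case (Cons p xs)
    obtain d v where p: "p = (d, v)" by (cases p)
    have "K w v = \<theta> w * cnj (\<theta> v) * K w v + K1 w v + K2 w v"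
      using split[OF \<open>w \<in> X\<close>, of v] Cons.prems p by (simp add: algebra_simps)
    then have "d * K w v = d * (\<theta> w * cnj (\<theta> v) * K w v + K1 w v + K2 w v)"
      by simp
    then show ?case
      using Cons \<open>w \<in> X\<close> by (simp add: p twist_def combination_Cons H1.combination_Cons
          H2.combination_Cons kernel_section_def algebra_simps)
  qed (simp add: twist_def)
  have contraction: "nrm (combination (twist xs)) \<le> nrm (combination xs)"
    if X: "snd ` set xs \<subseteq> X" for xs
  proof -
    \<comment> \<open>The outer list is generalised to \<open>ys\<close> so that the induction
      leaves the inner combinations of \<open>xs\<close> fixed. For \<open>ys\<close> equal to
      \<open>xs\<close> the identity splits the squared norm into three squared norms, taken in
      \<open>H\<close>, \<open>H1\<close> and \<open>H2\<close>.\<close>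
    have "(\<Sum>(c, w)\<leftarrow>ys. c * cnj (combination xs w))
        = (\<Sum>(c, w)\<leftarrow>twist ys. c * cnj (combination (twist xs) w))
          + (\<Sum>(c, w)\<leftarrow>ys. c * cnj (H1.combination xs w))
          + (\<Sum>(c, w)\<leftarrow>ys. c * cnj (H2.combination xs w))" if "snd ` set ys \<subseteq> X" for ys
      using that
    proof (induction ys)
      case (Cons p ys)
      then show ?case
        by (cases p) (simp add: twist_def pointwise[OF X] algebra_simps)
    qed (simp add: twist_def)
    from this[OF X] have "of_real ((nrm (combination xs))\<^sup>2) = (of_real ((nrm (combination (twist xs)))\<^sup>2
        + (H1.nrm (H1.combination xs))\<^sup>2 + (H2.nrm (H2.combination xs))\<^sup>2) :: complex)"
      unfolding of_real_add using nrm_sq_combination X twist_X H1.nrm_sq_combination H2.nrm_sq_combination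
      by metis
    then have "(nrm (combination xs))\<^sup>2 = (nrm (combination (twist xs)))\<^sup>2
        + (H1.nrm (H1.combination xs))\<^sup>2 + (H2.nrm (H2.combination xs))\<^sup>2"
      using of_real_eq_iff by blast
    then have "(nrm (combination (twist xs)))\<^sup>2 \<le> (nrm (combination xs))\<^sup>2"
      by simp
    then show ?thesis
      by (rule power2_le_imp_le) (simp add: X combination_mem nrm_nonneg)
  qed
  \<comment> \<open>The functional to be represented. By \<open>a_twist\<close> it is the inner
    product of the twisted combination with \<open>f\<close>, hence bounded; by its formula it takes
    the value \<open>cnj (\<theta> w * f w)\<close> at the section of w, which identifies the
    representing vector.\<close>
  define a where "a xs = (\<Sum>(c, w)\<leftarrow>xs. c * cnj (\<theta> w * f w))" for xs
  have a_twist: "a xs = ip (combination (twist xs)) f" if "snd ` set xs \<subseteq> X" for xs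
    using ip_combination_left[OF f, of "twist xs"] that twist_X
    by (simp add: a_def twist_def comp_def case_prod_unfold mult.assoc)
  let ?G = "(\<lambda>xs. (combination xs, a xs)) ` {xs. snd ` set xs \<subseteq> X}"
  have G_add: "((\<lambda>x. u x + v x), b + c) \<in> ?G" if uv: "(u, b) \<in> ?G" "(v, c) \<in> ?G" for u b v c
  proof -
    obtain xs ys where "snd ` set xs \<subseteq> X" "(u, b) = (combination xs, a xs)"
      "snd ` set ys \<subseteq> X" "(v, c) = (combination ys, a ys)" using uv by auto
    then show ?thesis
      by (intro image_eqI[of _ _ "xs @ ys"]) (auto simp: combination_append a_def)
  qed
  have G_scale: "((\<lambda>x. d * u x), d * b) \<in> ?G" if u: "(u, b) \<in> ?G" for u b d
  proof -
    obtain xs where xs: "snd ` set xs \<subseteq> X" "(u, b) = (combination xs, a xs)" using u by auto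
    have "a (map (\<lambda>(e, w). (d * e, w)) xs) = d * a xs"
      by (induction xs) (auto simp: a_def algebra_simps)
    with xs show ?thesis
      by (intro image_eqI[of _ _ "map (\<lambda>(e, w). (d * e, w)) xs"]) (auto simp: combination_scale)
  qed
  obtain g where g: "g \<in> elems H" "\<And>u b. (u, b) \<in> ?G \<Longrightarrow> ip u g = b"
  proof (rule riesz_relation[of ?G "nrm f"])
    show "cmod b \<le> nrm f * nrm u" if u: "(u, b) \<in> ?G" for u b
    proof -
      obtain xs where xs: "snd ` set xs \<subseteq> X" "u = combination xs" "b = a xs" using u by auto
      have "cmod b \<le> nrm (combination (twist xs)) * nrm f"
        unfolding xs(3) a_twist[OF xs(1)]
        by (rule cauchy_schwarz) (simp_all add: f combination_mem xs(1) twist_X)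
      also have "\<dots> \<le> nrm u * nrm f"
        unfolding xs(2) by (intro mult_right_mono contraction xs(1) nrm_nonneg f)
      finally show ?thesis by (simp add: mult.commute)
    qed
    show "((\<lambda>_. 0), 0) \<in> ?G"
      by (rule image_eqI[of _ _ "[]"]) (auto simp: a_def)
    show "fst ` ?G \<subseteq> elems H" by (auto simp: combination_mem)
  qed (rule G_add G_scale that; assumption)+
  have "g w = \<theta> w * f w" if w: "w \<in> X" for w
  proof -
    have "ip (combination [(1, w)]) g = a [(1, w)]"
      by (rule g(2)) (use w in \<open>auto intro!: imageI\<close>)
    then show ?thesis
      using w g(1) by (simp add: a_def combination_Cons ip_section_left flip: complex_cnj_mult)
  qed
  moreover have "g w = \<theta> w * f w" if "w \<notin> X" for w
    using zero_outside[OF g(1) that] zero_outside[OF f that] by simp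
  ultimately have "g = (\<lambda>z. \<theta> z * f z)" by blast
  with g(1) show ?thesis by simp
qed

end

section \<open>Agler pairs over a backward shift\<close>

text \<open>Polarisation: comparing the norms of g + c f gives the real parts of c times the inner
  products, and c = 1 and c = \<i> determine both coordinates. It is called for because
  \<open>closed_subspace_of\<close> compares norms only.\<close>

lemma (in function_hilbert_space) isometric_inprod:
  assumes N: "function_hilbert_space X N" and sub: "elems N \<subseteq> elems H"
    and norm: "\<And>f. f \<in> elems N \<Longrightarrow> hnorm N f = nrm f"
    and f: "f \<in> elems N" and g: "g \<in> elems N"
  shows "inprod N f g = ip f g"
proof -
  interpret N: function_hilbert_space X N by (rule N)
  have "Re (c * inprod N f g) = Re (c * ip f g)" for c
  proof -
    have "(hnorm N (\<lambda>x. g x + c * f x))\<^sup>2 = (nrm (\<lambda>x. g x + c * f x))\<^sup>2"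
      using norm N.add_mem[OF g N.scale_mem[OF f]] by simp
    moreover have "f \<in> elems H" "g \<in> elems H" using f g sub by auto
    ultimately show ?thesis
      using f g norm by (simp add: nrm_sq_add_scaled N.nrm_sq_add_scaled)
  qed
  from this[of 1] this[of \<i>] show ?thesis
    by (simp add: complex_eq_iff)
qed

lemma one_minus_nonzero:
  fixes x y :: complex
  assumes "cmod x < 1" "cmod y < 1"
  shows "1 - x * cnj y \<noteq> 0"
proof -
  have "cmod (x * cnj y) < 1"
    using mult_strict_mono'[OF assms] by (simp add: norm_mult)
  then show ?thesis by auto
qed

locale backward_shift = rkhs X H K
  for X :: "'x set" and H :: "'x fun_space" and K :: "'x \<Rightarrow> 'x \<Rightarrow> complex" +
  fixes \<zeta> :: "'x \<Rightarrow> complex" and \<rho> :: "'x \<Rightarrow> 'x" and B :: "('x \<Rightarrow> complex) \<Rightarrow> 'x \<Rightarrow> complex"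
  assumes \<rho>_mem: "w \<in> X \<Longrightarrow> \<rho> w \<in> X"
    and \<zeta>_\<rho>: "w \<in> X \<Longrightarrow> \<zeta> (\<rho> w) = 0"
    and \<zeta>_less_1: "w \<in> X \<Longrightarrow> cmod (\<zeta> w) < 1"
    and shift_mem: "f \<in> elems H \<Longrightarrow> (\<lambda>z. \<zeta> z * f z) \<in> elems H"
    and B_mem: "f \<in> elems H \<Longrightarrow> B f \<in> elems H"
    and B_eval: "f \<in> elems H \<Longrightarrow> z \<in> X \<Longrightarrow> \<zeta> z * B f z = f z - f (\<rho> z)"
    and shift_adjoint: "f \<in> elems H \<Longrightarrow> h \<in> elems H \<Longrightarrow> ip (\<lambda>z. \<zeta> z * f z) h = ip f (B h)"
    and B_shift: "f \<in> elems H \<Longrightarrow> B (\<lambda>z. \<zeta> z * f z) = f"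
begin

lemma shift_adjoint': "f \<in> elems H \<Longrightarrow> h \<in> elems H \<Longrightarrow> ip (B h) f = ip h (\<lambda>z. \<zeta> z * f z)"
  using shift_adjoint[of f h] inprod_cnj[of f "B h"] inprod_cnj[of "\<lambda>z. \<zeta> z * f z" h] B_mem shift_mem
  by simp

text \<open>\<open>B\<close> is a left inverse of multiplication by \<zeta>. So a factor \<zeta> can
  be cancelled from an identity of functions in \<open>H\<close> even where \<zeta> vanishes and
  pointwise division is impossible.\<close>

lemma shift_injective:
  assumes "f \<in> elems H" "g \<in> elems H" "\<And>z. z \<in> X \<Longrightarrow> \<zeta> z * f z = \<zeta> z * g z"
  shows "f = g"
proof -
  have "(\<lambda>z. \<zeta> z * f z) = (\<lambda>z. \<zeta> z * g z)"
    using assms shift_mem by (intro eqI) auto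
  then show ?thesis using B_shift assms by metis
qed

text \<open>\<open>B\<close> is both the adjoint and a left inverse of the shift, so the shift is an
  isometry.\<close>

lemma nrm_shift: "f \<in> elems H \<Longrightarrow> nrm (\<lambda>z. \<zeta> z * f z) = nrm f"
  unfolding hnorm_def by (simp add: shift_adjoint shift_mem B_shift)

end

text \<open>
  Both statements of the theorem are instances of this locale, with the roles of the variables and
  of the two Agler kernels interchanged: \<open>\<zeta>\<close> is the variable of the shift and \<open>\<rho>\<close> sets it to 0.
\<close>

locale agler_pair = backward_shift X H K \<zeta> \<rho> B + S1: rkhs X S1 K1 + S2: rkhs X S2 K2
  for X :: "'x set" and H :: "'x fun_space" and K :: "'x \<Rightarrow> 'x \<Rightarrow> complex"
    and \<zeta> :: "'x \<Rightarrow> complex" and \<rho> :: "'x \<Rightarrow> 'x" and B :: "('x \<Rightarrow> complex) \<Rightarrow> 'x \<Rightarrow> complex"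
    and S1 S2 :: "'x fun_space" and K1 K2 :: "'x \<Rightarrow> 'x \<Rightarrow> complex" +
  fixes \<theta> :: "'x \<Rightarrow> complex" and L :: "'x \<Rightarrow> 'x \<Rightarrow> complex"
  assumes split: "z \<in> X \<Longrightarrow> w \<in> X \<Longrightarrow> (1 - \<theta> z * cnj (\<theta> w)) * K z w = K1 z w + K2 z w"
    and K1_eq: "z \<in> X \<Longrightarrow> w \<in> X \<Longrightarrow> K1 z w = L z w / (1 - \<zeta> z * cnj (\<zeta> w))"
    and L_positive: "positive_kernel X L"
begin

section \<open>The model space \<open>M\<close> and the compressed shift \<open>A\<close>\<close>

definition V where "V = (\<lambda>g z. \<theta> z * g z) ` elems H"
definition M where "M = orth_complement H V"
definition A where "A f = orth_projection H M (\<lambda>z. \<zeta> z * f z)"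

abbreviation k1 where "k1 \<equiv> kernel_section X K1"
abbreviation k2 where "k2 \<equiv> kernel_section X K2"

lemma V_subset: "V \<subseteq> elems H"
  unfolding V_def using multiplier_mem[OF S1.rkhs_axioms S2.rkhs_axioms split] by blast

lemma inprod_M [simp]: "inprod M = ip" and hnorm_M [simp]: "hnorm M f = nrm f"
  by (simp_all add: M_def orth_complement_def hnorm_def)

lemma M_iff: "f \<in> elems M \<longleftrightarrow> f \<in> elems H \<and> (\<forall>g\<in>elems H. ip f (\<lambda>z. \<theta> z * g z) = 0)"
  by (auto simp: M_def orth_complement_def V_def)

lemma M_H: "f \<in> elems M \<Longrightarrow> f \<in> elems H"
  by (simp add: M_iff)

lemma M_linear: "linear_subspace (elems M)"
  unfolding M_def by (rule complement_linear[OF V_subset])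

lemma M_diff: "f \<in> elems M \<Longrightarrow> g \<in> elems M \<Longrightarrow> (\<lambda>x. f x - g x) \<in> elems M"
  by (rule linear_subspace_diff[OF M_linear])

text \<open>Multiplication by \<zeta> maps the multiples of \<theta> to multiples of \<theta>, so
  its adjoint preserves their orthogonal complement.\<close>

lemma B_M:
  assumes "f \<in> elems M"
  shows "B f \<in> elems M"
  unfolding M_iff
proof (intro conjI ballI)
  fix g assume g: "g \<in> elems H"
  have "(\<lambda>z. \<theta> z * g z) \<in> elems H" using V_subset g by (auto simp: V_def)
  then have "ip (B f) (\<lambda>z. \<theta> z * g z) = ip f (\<lambda>z. \<theta> z * (\<zeta> z * g z))"
    using shift_adjoint' assms M_H by (simp add: mult.left_commute)
  also have "\<dots> = 0"
    using assms shift_mem[OF g] by (simp add: M_iff)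
  finally show "ip (B f) (\<lambda>z. \<theta> z * g z) = 0" .
qed (use assms M_H B_mem in blast)

lemma A_mem: "f \<in> elems H \<Longrightarrow> A f \<in> elems M"
  unfolding A_def M_def by (rule projection_on_complement[OF V_subset shift_mem])

lemma A_ip:
  assumes "f \<in> elems H" "h \<in> elems M"
  shows "ip (A f) h = ip (\<lambda>z. \<zeta> z * f z) h"
proof -
  have "ip (\<lambda>z. \<zeta> z * f z - A f z) h = 0"
    using projection_on_complement(2)[OF V_subset shift_mem] assms unfolding A_def M_def by blast
  then show ?thesis
    using assms M_H A_mem shift_mem by (simp add: ip_diff_left)
qed

lemma A_eq:
  assumes "f \<in> elems H" "(\<lambda>z. \<zeta> z * f z) \<in> elems M"
  shows "A f = (\<lambda>z. \<zeta> z * f z)"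
proof -
  let ?d = "\<lambda>z. A f z - \<zeta> z * f z"
  have d: "?d \<in> elems M" using M_diff A_mem assms by blast
  have "ip ?d ?d = 0"
    unfolding ip_diff_left[OF M_H[OF A_mem[OF assms(1)]] M_H[OF assms(2)] M_H[OF d]]
    using A_ip[OF assms(1) d] by simp
  then have "?d = (\<lambda>_. 0)" using d M_H inprod_definite by blast
  then show ?thesis by (simp add: fun_eq_iff)
qed

text \<open>The adjoint of a compression is the compression of the adjoint, and \<open>B\<close>
  needs no projection because it already maps \<open>M\<close> into itself by
  \<open>B_M\<close>.\<close>

lemma hadjoint_A:
  assumes "g \<in> elems M"
  shows "hadjoint M A g = B g"
  unfolding hadjoint_def inprod_M
proof (rule the_equality)
  show "B g \<in> elems M \<and> (\<forall>f\<in>elems M. ip (A f) g = ip f (B g))"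
    using assms B_M A_ip M_H shift_adjoint by simp
next
  fix h assume h: "h \<in> elems M \<and> (\<forall>f\<in>elems M. ip (A f) g = ip f h)"
  let ?d = "\<lambda>z. h z - B g z"
  have d: "?d \<in> elems M" using M_diff h B_M assms by blast
  have "ip ?d h = ip (A ?d) g" using h d by simp
  also have "\<dots> = ip ?d (B g)" using d assms A_ip M_H shift_adjoint by simp
  finally have "ip ?d h = ip ?d (B g)" .
  then have "ip ?d ?d = 0"
    using ip_diff_right[of h "B g" ?d] h M_H[OF d] M_H assms B_mem by simp
  then have "?d = (\<lambda>_. 0)" using d M_H inprod_definite by blast
  then show "h = B g" by (simp add: fun_eq_iff)
qed

lemma reducing_iff:
  "reducing_subspace M A N \<longleftrightarrow>
    closed_subspace_of N M \<and> (\<forall>f\<in>elems N. A f \<in> elems N) \<and> (\<forall>f\<in>elems N. B f \<in> elems N)"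
proof (cases "closed_subspace_of N M")
  case True
  then have "hadjoint M A f = B f" if "f \<in> elems N" for f
    using that hadjoint_A unfolding closed_subspace_of_def by blast
  then show ?thesis by (simp add: reducing_subspace_def)
qed (simp add: reducing_subspace_def)

lemma closed_subspace_inprod:
  assumes "function_hilbert_space X N" "closed_subspace_of N M" "f \<in> elems N" "g \<in> elems N"
  shows "inprod N f g = ip f g"
proof (rule isometric_inprod[OF assms(1)])
  show "elems N \<subseteq> elems H" using assms(2) M_H by (auto simp: closed_subspace_of_def)
  show "hnorm N f = nrm f" if "f \<in> elems N" for f
    using assms(2) that by (simp add: closed_subspace_of_def)
qed (fact assms)+

lemma L_eq: "z \<in> X \<Longrightarrow> w \<in> X \<Longrightarrow> L z w = (1 - \<zeta> z * cnj (\<zeta> w)) * K1 z w"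
  using K1_eq one_minus_nonzero[OF \<zeta>_less_1 \<zeta>_less_1] by simp

lemma L_hermitian: "z \<in> X \<Longrightarrow> w \<in> X \<Longrightarrow> L w z = cnj (L z w)"
  using S1.kernel_hermitian[of z w] by (simp add: L_eq mult.commute)

text \<open>Positivity of \<open>L\<close> is tested with the coefficients 1 at \<open>z\<close> and
  -1 at \<open>w\<close>. The case of equal points is separate because the two-point set then
  collapses.\<close>

lemma L_two_points:
  assumes z: "z \<in> X" and w: "w \<in> X"
  shows "2 * Re (L z w) \<le> Re (L z z) + Re (L w w)"
proof (cases "z = w")
  case False
  define c :: "'x \<Rightarrow> complex" where "c x = (if x = z then 1 else - 1)" for x
  have "(\<Sum>x\<in>{z, w}. \<Sum>y\<in>{z, w}. c x * cnj (c y) * L x y) \<in> \<real>\<^sub>\<ge>\<^sub>0"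
    by (rule L_positive[unfolded positive_kernel_def, rule_format]) (simp add: z w)
  moreover have "(\<Sum>x\<in>{z, w}. \<Sum>y\<in>{z, w}. c x * cnj (c y) * L x y) = L z z - L z w - L w z + L w w"
    using False by (simp add: c_def)
  ultimately have "0 \<le> Re (L z z - L z w - L w z + L w w)"
    by (simp only: complex_nonneg_Reals_iff)
  then show ?thesis using L_hermitian[OF z w] by simp
qed simp

text \<open>By Pythagoras, \<open>\<zeta> k1\<^sub>w - A k1\<^sub>w\<close> has a norm that positivity of \<open>L\<close> at the two points
  \<open>w\<close> and \<open>\<rho> w\<close> forces to vanish.\<close>

lemma invariant_imp_L:
  assumes closed: "closed_subspace_of S1 M"
    and A_inv: "\<And>f. f \<in> elems S1 \<Longrightarrow> A f \<in> elems S1"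
    and B_inv: "\<And>f. f \<in> elems S1 \<Longrightarrow> B f \<in> elems S1"
    and z: "z \<in> X" and w: "w \<in> X"
  shows "L z w = L z (\<rho> w)"
proof -
  have S1_M: "f \<in> elems M" if "f \<in> elems S1" for f
    using closed that by (auto simp: closed_subspace_of_def)
  then have S1_H: "f \<in> elems H" if "f \<in> elems S1" for f
    using that M_H by blast
  note ip_S1 = closed_subspace_inprod[OF S1.function_hilbert_space_axioms closed]
  have k_mem: "k1 v \<in> elems S1" if "v \<in> X" for v by (rule S1.section_mem[OF that])
  have eval: "ip f (k1 v) = f v" if "f \<in> elems S1" "v \<in> X" for f v
    using S1.reproducing[OF that] ip_S1[OF that(1) k_mem[OF that(2)]] by simp
  have sect: "ip (k1 v) (k1 u) = K1 u v" if "u \<in> X" "v \<in> X" for u v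
    unfolding eval[OF k_mem[OF that(2)] that(1)] using that by (simp add: kernel_section_def)
  have nrm_section: "(nrm (k1 v))\<^sup>2 = Re (K1 v v)" if "v \<in> X" for v
    using arg_cong[OF ip_self[OF S1_H[OF k_mem[OF that]]], of Re]
    unfolding sect[OF that that] Re_complex_of_real by simp
  note [simp] = S1_H k_mem w \<rho>_mem A_inv B_inv
  let ?a = "A (k1 w)"
  let ?e = "\<lambda>x. cnj (\<zeta> w) * ?a x" and ?g = "\<lambda>x. k1 w x - k1 (\<rho> w) x"
  have e_mem: "?e \<in> elems S1" and g_mem: "?g \<in> elems S1"
    by (simp_all add: S1.scale_mem S1.diff_mem)
  \<comment> \<open>Pairing f with A k_w moves the shift to \<open>B f\<close>, which is again in
    \<open>S1\<close>, so the reproducing property evaluates it at \<open>w\<close>. By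
    \<open>B_eval\<close> both sides equal f w - f (\<rho> w).\<close>
  have "ip f ?e = ip f ?g" if f: "f \<in> elems S1" for f
  proof -
    have "ip ?a f = ip (k1 w) (B f)"
      using A_ip[of "k1 w" f] shift_adjoint[of "k1 w" f] S1_M f by simp
    then have "ip f ?a = B f w"
      using inprod_cnj[of ?a f] inprod_cnj[of "k1 w" "B f"] eval[of "B f" w] f by simp
    then have "ip f ?e = \<zeta> w * B f w"
      using f by (simp add: ip_scale_right)
    also have "\<dots> = ip f ?g"
      using f by (simp add: B_eval ip_diff_right eval)
    finally show ?thesis .
  qed
  then have "ip (\<lambda>x. ?e x - ?g x) (\<lambda>x. ?e x - ?g x) = 0"
    using S1.diff_mem[OF e_mem g_mem] e_mem g_mem by (simp add: ip_diff_right)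
  then have "(\<lambda>x. ?e x - ?g x) = (\<lambda>_. 0)"
    using S1.diff_mem[OF e_mem g_mem] inprod_definite S1_H by blast
  then have e_eq: "?e = ?g" by (simp add: fun_eq_iff)
  \<comment> \<open>\<open>?r\<close> is the component of \<zeta> k_w orthogonal to
    \<open>M\<close>. The shift is isometric, so Pythagoras gives its norm from those of k_w and A
    k_w.\<close>
  let ?T = "\<lambda>x. \<zeta> x * k1 w x" and ?r = "\<lambda>x. \<zeta> x * k1 w x - ?a x"
  have r_H: "?r \<in> elems H" by (simp add: diff_mem shift_mem)
  have "ip ?a ?T = ip ?a ?a"
    using inprod_cnj[of ?T ?a] inprod_cnj[of ?a ?a] A_ip[of "k1 w" ?a] S1_M by (simp add: shift_mem)
  then have "(nrm ?r)\<^sup>2 = (nrm (k1 w))\<^sup>2 - (nrm ?a)\<^sup>2"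
    using nrm_sq_diff[of ?T ?a] by (simp add: shift_mem nrm_shift ip_self)
  \<comment> \<open>Multiplying by the squared modulus of \<zeta> w replaces \<open>?a\<close> by
    \<open>?e\<close>, which has been identified with \<open>?g\<close>; dividing by \<zeta> w is
    avoided since it may be 0.\<close>
  then have "(cmod (\<zeta> w))\<^sup>2 * (nrm ?r)\<^sup>2 = (cmod (\<zeta> w))\<^sup>2 * (nrm (k1 w))\<^sup>2 - (nrm ?e)\<^sup>2"
    by (simp add: nrm_scale power_mult_distrib right_diff_distrib)
  also have "(nrm ?e)\<^sup>2 = (nrm (k1 w))\<^sup>2 - 2 * Re (ip (k1 (\<rho> w)) (k1 w)) + (nrm (k1 (\<rho> w)))\<^sup>2"
    unfolding e_eq by (rule nrm_sq_diff) simp_all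
  \<comment> \<open>Since \<zeta> vanishes at \<rho> w, the kernels \<open>K1\<close> and
    \<open>L\<close> agree as soon as one argument is \<rho> w.\<close>
  also have "ip (k1 (\<rho> w)) (k1 w) = L w (\<rho> w)"
    by (simp add: sect L_eq \<zeta>_\<rho>)
  also have "(nrm (k1 w))\<^sup>2 = Re (K1 w w)"
    by (simp add: nrm_section)
  also have "(nrm (k1 (\<rho> w)))\<^sup>2 = Re (L (\<rho> w) (\<rho> w))"
    by (simp add: nrm_section L_eq \<zeta>_\<rho>)
  also have "(cmod (\<zeta> w))\<^sup>2 * Re (K1 w w) - (Re (K1 w w) - 2 * Re (L w (\<rho> w)) + Re (L (\<rho> w) (\<rho> w)))
      = 2 * Re (L w (\<rho> w)) - Re (L w w) - Re (L (\<rho> w) (\<rho> w))"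
  proof -
    have "L w w = of_real (1 - (cmod (\<zeta> w))\<^sup>2) * K1 w w"
      by (simp only: L_eq[OF w w] of_real_diff of_real_1 complex_norm_square)
    then have "Re (L w w) = (1 - (cmod (\<zeta> w))\<^sup>2) * Re (K1 w w)"
      by (simp only: Re_complex_of_real times_complex.sel Im_complex_of_real)
    then show ?thesis by (simp add: left_diff_distrib)
  qed
  also have "\<dots> \<le> 0"
    using L_two_points[of w "\<rho> w"] by simp
  finally have "(cmod (\<zeta> w))\<^sup>2 * (nrm ?r)\<^sup>2 \<le> 0" .
  then have "\<zeta> w = 0 \<or> nrm ?r = 0"
    by (auto simp: mult_le_0_iff)
  then have "cnj (\<zeta> w) * ?r z = 0"
    using nrm_eq_0[OF r_H] by (auto simp: fun_eq_iff)
  then have "cnj (\<zeta> w) * (\<zeta> z * k1 w z) = cnj (\<zeta> w) * ?a z"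
    by (simp only: right_diff_distrib right_minus_eq)
  also have "\<dots> = k1 w z - k1 (\<rho> w) z"
    using fun_cong[OF e_eq, of z] .
  finally show ?thesis
    using z by (simp add: L_eq kernel_section_def \<zeta>_\<rho> algebra_simps)
qed

text \<open>By \<open>split\<close>, the sections of \<open>K1\<close> and \<open>K2\<close> at
  \<open>w\<close> sum to the section of \<open>K\<close> minus a multiple of \<theta> times that
  section. Elements of \<open>M\<close> annihilate the latter, so the sum reproduces values on
  \<open>M\<close>.\<close>

lemma ip_section_sum:
  assumes closed: "closed_subspace_of S1 M" "closed_subspace_of S2 M"
    and f: "f \<in> elems M" and w: "w \<in> X"
  shows "f w = ip f (k1 w) + ip f (k2 w)"
proof -
  have k: "k1 w \<in> elems H" "k2 w \<in> elems H"
    using S1.section_mem[OF w] S2.section_mem[OF w] closed M_H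
    by (auto simp: closed_subspace_of_def)
  let ?s = "kernel_section X K w"
  have s: "?s \<in> elems H" "(\<lambda>z. \<theta> z * ?s z) \<in> elems H"
    using section_mem[OF w] V_subset by (auto simp: V_def)
  have "?s = (\<lambda>z. (k1 w z + k2 w z) + cnj (\<theta> w) * (\<theta> z * ?s z))"
    using split w by (auto simp: fun_eq_iff kernel_section_def algebra_simps)
  then have "ip f ?s = ip f (\<lambda>z. (k1 w z + k2 w z) + cnj (\<theta> w) * (\<theta> z * ?s z))"
    by (rule arg_cong)
  also have "\<dots> = ip f (k1 w) + ip f (k2 w) + \<theta> w * ip f (\<lambda>z. \<theta> z * ?s z)"
    using k s f M_H by (simp add: ip_add_right ip_scale_right add_mem scale_mem)
  also have "ip f (\<lambda>z. \<theta> z * ?s z) = 0"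
    using f s by (simp add: M_iff)
  finally show ?thesis
    using reproducing[of f w] f w M_H by simp
qed

text \<open>The vector \<open>q\<close> is the orthogonal projection of \<open>f\<close> onto
  \<open>N\<close>. It comes from Riesz representation inside \<open>N\<close>, a Hilbert space in
  its own right, whose inner product agrees with that of \<open>H\<close>.\<close>

lemma subspace_projection:
  assumes N: "function_hilbert_space X N" and closed: "closed_subspace_of N M" and f: "f \<in> elems H"
  obtains q where "q \<in> elems N" "\<And>u. u \<in> elems N \<Longrightarrow> ip u q = ip u f"
proof -
  interpret N: function_hilbert_space X N by (rule N)
  have N_H: "u \<in> elems H" if "u \<in> elems N" for u
    using that closed M_H by (auto simp: closed_subspace_of_def)
  have norm: "hnorm N u = nrm u" if "u \<in> elems N" for u
    using that closed by (simp add: closed_subspace_of_def)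
  obtain q where "q \<in> elems N" "\<And>u. u \<in> elems N \<Longrightarrow> inprod N u q = ip u f"
  proof (rule N.riesz[of "\<lambda>u. ip u f" "nrm f"])
    fix u assume "u \<in> elems N"
    then show "cmod (ip u f) \<le> nrm f * hnorm N u"
      using cauchy_schwarz[OF f, of u] N_H norm by (simp add: mult.commute)
  qed (use f N_H inprod_add inprod_scale in \<open>simp_all\<close>)
  then show ?thesis
    using that closed_subspace_inprod[OF N closed] by metis
qed

text \<open>The hypothesis has two readings. By \<open>K1_\<rho>\<close>, multiplying \<zeta> k_w by
  \<open>cnj (\<zeta> w)\<close> gives a difference of two sections, hence an element of
  \<open>S1\<close>. With hermitian symmetry, k_w is an eigenvector of \<open>B\<close> for the
  eigenvalue \<open>cnj (\<zeta> w)\<close>. The first yields invariance of the complement under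
  \<open>B\<close>, the second under \<zeta>.\<close>

lemma L_imp_reducing:
  assumes closed1: "closed_subspace_of S1 M" and closed2: "closed_subspace_of S2 M"
    and L_\<rho>: "\<And>z w. z \<in> X \<Longrightarrow> w \<in> X \<Longrightarrow> L z w = L z (\<rho> w)"
  shows "reducing_subspace M A S1" and "reducing_subspace M A S2"
proof -
  have S1_M: "f \<in> elems M" if "f \<in> elems S1" for f
    using closed1 that by (auto simp: closed_subspace_of_def)
  then have S1_H: "f \<in> elems H" if "f \<in> elems S1" for f
    using that M_H by blast
  have S2_M: "f \<in> elems M" if "f \<in> elems S2" for f
    using closed2 that by (auto simp: closed_subspace_of_def)
  note ip_S1 = closed_subspace_inprod[OF S1.function_hilbert_space_axioms closed1]
  have k_mem: "k1 v \<in> elems S1" if "v \<in> X" for v by (rule S1.section_mem[OF that])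
  have k_H: "k1 v \<in> elems H" if "v \<in> X" for v by (rule S1_H[OF k_mem[OF that]])
  have eval: "ip f (k1 v) = f v" if "f \<in> elems S1" "v \<in> X" for f v
    using S1.reproducing[OF that] ip_S1[OF that(1) k_mem[OF that(2)]] by simp
  note proj1 = subspace_projection[OF S1.function_hilbert_space_axioms closed1]
  have K1_\<rho>: "\<zeta> z * (cnj (\<zeta> w) * K1 z w) = K1 z w - K1 z (\<rho> w)" if "z \<in> X" "w \<in> X" for z w
    using L_\<rho>[OF that] that by (simp add: L_eq \<rho>_mem \<zeta>_\<rho> algebra_simps)
  have K1_swap: "K1 z (\<rho> w) = K1 (\<rho> z) w" if "z \<in> X" "w \<in> X" for z w
  proof -
    have "K1 z (\<rho> w) = L z w" using L_\<rho>[OF that] that by (simp add: L_eq \<rho>_mem \<zeta>_\<rho>)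
    also have "\<dots> = cnj (L w (\<rho> z))" using L_hermitian[OF that(2,1)] L_\<rho>[OF that(2,1)] by simp
    also have "\<dots> = L (\<rho> z) w" using L_hermitian[of w "\<rho> z"] that \<rho>_mem by simp
    also have "\<dots> = K1 (\<rho> z) w" using that by (simp add: L_eq \<rho>_mem \<zeta>_\<rho>)
    finally show ?thesis .
  qed
  \<comment> \<open>The complement is taken in all of \<open>H\<close>, where multiplication by
    \<zeta> acts without a projection.\<close>
  define P where "P = {f \<in> elems H. \<forall>u\<in>elems S1. ip u f = 0}"
  \<comment> \<open>Orthogonality to the sections suffices: the projection of \<open>f\<close> onto
    \<open>S1\<close> then vanishes at every point.\<close>
  have P_I: "f \<in> P" if f: "f \<in> elems H" and *: "\<And>w. w \<in> X \<Longrightarrow> ip (k1 w) f = 0" for f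
  proof -
    obtain q where q: "q \<in> elems S1" "\<And>u. u \<in> elems S1 \<Longrightarrow> ip u q = ip u f"
      using proj1[OF f] by blast
    have "q w = 0" if "w \<in> X" for w
      using eval[OF q(1) that] q(2)[OF k_mem[OF that]] *[OF that]
        inprod_cnj[OF k_H[OF that] S1_H[OF q(1)]] by simp
    then have "q = (\<lambda>_. 0)" using S1.zero_outside[OF q(1)] by blast
    then show ?thesis using q(2) f by (simp add: P_def S1_H ip_zero_right)
  qed
  have P_B: "B f \<in> P" if f: "f \<in> P" for f
  proof -
    have f_H: "f \<in> elems H" and f_S1: "\<And>u. u \<in> elems S1 \<Longrightarrow> ip u f = 0"
      using f by (auto simp: P_def)
    obtain q where q: "q \<in> elems S1" "\<And>u. u \<in> elems S1 \<Longrightarrow> ip u q = ip u (B f)"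
      using proj1[OF B_mem[OF f_H]] by blast
    \<comment> \<open>The values of the projection \<open>q\<close> of \<open>B f\<close> are
      accessible only after multiplication by \<zeta> w, which puts a difference of sections in
      place of \<zeta> k_w; \<open>shift_injective\<close> removes the factor.\<close>
    have "q = (\<lambda>_. 0)"
    proof (rule shift_injective)
      fix w assume w: "w \<in> X"
      have eq: "(\<lambda>z. cnj (\<zeta> w) * (\<zeta> z * k1 w z)) = (\<lambda>z. k1 w z - k1 (\<rho> w) z)"
        using K1_\<rho>[OF _ w] by (auto simp: fun_eq_iff kernel_section_def mult.left_commute)
      have "cnj (\<zeta> w * q w) = cnj (\<zeta> w) * ip (k1 w) q"
        using eval[OF q(1) w] inprod_cnj[OF S1_H[OF q(1)] k_H[OF w]] by simp
      also have "\<dots> = cnj (\<zeta> w) * ip (\<lambda>z. \<zeta> z * k1 w z) f"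
        using q(2)[OF k_mem[OF w]] shift_adjoint[OF k_H[OF w] f_H] by simp
      also have "\<dots> = ip (\<lambda>z. k1 w z - k1 (\<rho> w) z) f"
        unfolding eq[symmetric] by (rule inprod_scale[symmetric]) (rule shift_mem k_H w f_H)+
      also have "\<dots> = 0"
        by (rule f_S1) (intro S1.diff_mem k_mem w \<rho>_mem)
      finally have "cnj (\<zeta> w * q w) = cnj 0" by simp
      then have "\<zeta> w * q w = 0" by (rule complex_cnj_cancel_iff[THEN iffD1])
      then show "\<zeta> w * q w = \<zeta> w * 0" by simp
    qed (use q(1) S1_H zero_mem in auto)
    then show ?thesis
      using q(2) by (simp add: P_def B_mem f_H S1_H ip_zero_right)
  qed
  have P_shift: "(\<lambda>z. \<zeta> z * f z) \<in> P" if f: "f \<in> P" for f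
  proof (rule P_I)
    have f_H: "f \<in> elems H" using f by (simp add: P_def)
    then show "(\<lambda>z. \<zeta> z * f z) \<in> elems H" by (rule shift_mem)
    fix w assume w: "w \<in> X"
    \<comment> \<open>\<open>B\<close> takes a difference in the first argument of
      \<open>K1\<close>, whereas \<open>K1_\<rho>\<close> has one in the second;
      \<open>K1_swap\<close> exchanges them.\<close>
    have "B (k1 w) = (\<lambda>z. cnj (\<zeta> w) * k1 w z)"
    proof (rule shift_injective)
      fix z assume z: "z \<in> X"
      have "\<zeta> z * B (k1 w) z = K1 z w - K1 (\<rho> z) w"
        using B_eval[OF k_H[OF w] z] z \<rho>_mem by (simp add: kernel_section_def)
      also have "\<dots> = \<zeta> z * (cnj (\<zeta> w) * K1 z w)"
        using K1_\<rho>[OF z w] K1_swap[OF z w] by simp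
      finally show "\<zeta> z * B (k1 w) z = \<zeta> z * (cnj (\<zeta> w) * k1 w z)"
        using z by (simp add: kernel_section_def)
    qed (rule B_mem scale_mem k_H w)+
    then have "ip (k1 w) (\<lambda>z. \<zeta> z * f z) = cnj (\<zeta> w) * ip (k1 w) f"
      using shift_adjoint'[OF f_H k_H[OF w]] inprod_scale[OF k_H[OF w] f_H] by simp
    also have "ip (k1 w) f = 0"
      using f k_mem[OF w] by (simp add: P_def)
    finally show "ip (k1 w) (\<lambda>z. \<zeta> z * f z) = 0" by simp
  qed
  \<comment> \<open>Double complement: \<open>f\<close> minus its projection onto \<open>S1\<close>
    lies in \<open>P\<close>, so it is orthogonal to \<open>f\<close> and to the projection, hence
    to itself.\<close>
  have S1_I: "f \<in> elems S1" if f: "f \<in> elems H" and *: "\<And>p. p \<in> P \<Longrightarrow> ip f p = 0" for f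
  proof -
    obtain q where q: "q \<in> elems S1" "\<And>u. u \<in> elems S1 \<Longrightarrow> ip u q = ip u f"
      using proj1[OF f] by blast
    let ?d = "\<lambda>x. f x - q x"
    have d: "?d \<in> elems H" using f S1_H[OF q(1)] by (rule diff_mem)
    have d_S1: "ip u ?d = 0" if "u \<in> elems S1" for u
      using q(2)[OF that] by (simp add: ip_diff_right f S1_H q(1) that)
    then have "?d \<in> P" using d by (simp add: P_def)
    then have "ip ?d ?d = 0"
      using *[of ?d] d_S1[OF q(1)] ip_diff_left[OF f S1_H[OF q(1)] d] by simp
    then have "?d = (\<lambda>_. 0)" by (rule inprod_definite[OF d])
    then have "f = q" by (simp add: fun_eq_iff)
    with q(1) show ?thesis by simp
  qed
  have shift_S1: "(\<lambda>z. \<zeta> z * f z) \<in> elems S1" if f: "f \<in> elems S1" for f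
  proof (rule S1_I)
    fix p assume p: "p \<in> P"
    then have "ip (\<lambda>z. \<zeta> z * f z) p = ip f (B p)"
      using shift_adjoint S1_H[OF f] by (simp add: P_def)
    also have "\<dots> = 0" using P_B[OF p] f by (simp add: P_def)
    finally show "ip (\<lambda>z. \<zeta> z * f z) p = 0" .
  qed (rule shift_mem S1_H f)+
  have B_S1: "B f \<in> elems S1" if f: "f \<in> elems S1" for f
  proof (rule S1_I)
    fix p assume p: "p \<in> P"
    then have "ip (B f) p = ip f (\<lambda>z. \<zeta> z * p z)"
      using shift_adjoint' S1_H[OF f] by (simp add: P_def)
    also have "\<dots> = 0" using P_shift[OF p] f by (simp add: P_def)
    finally show "ip (B f) p = 0" .
  qed (rule B_mem S1_H f)+
  \<comment> \<open>On \<open>S1\<close> the projection in \<open>A\<close> acts trivially, because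
    \<zeta> f stays in \<open>S1\<close> and thus in \<open>M\<close>.\<close>
  have A_S1: "A f = (\<lambda>z. \<zeta> z * f z)" if "f \<in> elems S1" for f
    by (rule A_eq[OF S1_H[OF that] S1_M[OF shift_S1[OF that]]])
  show "reducing_subspace M A S1"
    unfolding reducing_iff using closed1 shift_S1 B_S1 A_S1 by simp
  \<comment> \<open>Both directions compare \<open>ip_section_sum\<close> with the reproducing
    property of \<open>S2\<close>. For f in \<open>S2\<close> the pairing with \<open>k2 w\<close>
    already gives f w, so the one with \<open>k1 w\<close> vanishes. For f in \<open>M\<close> and
    \<open>P\<close> the projection onto \<open>S2\<close> has the same values as f.\<close>
  have S2_iff: "f \<in> elems S2 \<longleftrightarrow> f \<in> elems M \<and> f \<in> P" for f
  proof (intro iffI conjI)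
    assume f: "f \<in> elems S2"
    then show f_M: "f \<in> elems M" by (rule S2_M)
    show "f \<in> P"
    proof (rule P_I)
      fix w assume w: "w \<in> X"
      have "ip f (k2 w) = f w"
        using S2.reproducing[OF f w] closed_subspace_inprod[OF S2.function_hilbert_space_axioms closed2 f
            S2.section_mem[OF w]] by simp
      then have "ip f (k1 w) = 0"
        using ip_section_sum[OF closed1 closed2 f_M w] by simp
      then show "ip (k1 w) f = 0"
        using inprod_cnj[OF M_H[OF f_M] k_H[OF w]] by simp
    qed (rule M_H[OF f_M])
  next
    assume f: "f \<in> elems M \<and> f \<in> P"
    then have f_H: "f \<in> elems H" using M_H by blast
    obtain q where q: "q \<in> elems S2" "\<And>u. u \<in> elems S2 \<Longrightarrow> ip u q = ip u f"
      using subspace_projection[OF S2.function_hilbert_space_axioms closed2 f_H] by blast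
    have "f = q"
    proof (rule eqI)
      fix w assume w: "w \<in> X"
      have k2: "k2 w \<in> elems S2" by (rule S2.section_mem[OF w])
      note k2_H = M_H[OF S2_M[OF k2]] and q_H = M_H[OF S2_M[OF q(1)]]
      have "q w = ip q (k2 w)"
        using S2.reproducing[OF q(1) w]
          closed_subspace_inprod[OF S2.function_hilbert_space_axioms closed2 q(1) k2] by simp
      also have "\<dots> = ip f (k2 w)"
        using q(2)[OF k2] inprod_cnj[OF k2_H q_H] inprod_cnj[OF k2_H f_H] by simp
      also have "\<dots> = f w"
        using f k_mem[OF w] inprod_cnj[OF k_H[OF w] f_H] ip_section_sum[OF closed1 closed2 _ w, of f]
        by (simp add: P_def)
      finally show "f w = q w" ..
    qed (use f_H q(1) S2_M M_H in auto)
    with q(1) show "f \<in> elems S2" by simp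
  qed
  have "A f \<in> P" if f: "f \<in> elems S2" for f
  proof -
    have f_H: "f \<in> elems H" using S2_M[OF f] by (rule M_H)
    note Af_H = M_H[OF A_mem[OF f_H]]
    \<comment> \<open>Invariance of \<open>S1\<close> under the adjoint \<open>B\<close> of
      \<open>A\<close> makes its complement invariant under \<open>A\<close>.\<close>
    have "ip u (A f) = 0" if u: "u \<in> elems S1" for u
    proof -
      have "ip (A f) u = ip f (B u)"
        using A_ip[OF f_H S1_M[OF u]] shift_adjoint[OF f_H S1_H[OF u]] by simp
      also have "\<dots> = 0"
        using f B_S1[OF u] inprod_cnj[OF S1_H[OF B_S1[OF u]] f_H] S2_iff by (simp add: P_def)
      finally show ?thesis using inprod_cnj[OF Af_H S1_H[OF u]] by simp
    qed
    then show ?thesis using Af_H by (simp add: P_def)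
  qed
  then show "reducing_subspace M A S2"
    unfolding reducing_iff using closed2 S2_iff A_mem B_M P_B M_H by blast
qed

text \<open>Hermitian symmetry carries the independence from the second argument over to the
  first.\<close>

lemma L_depends_on_\<rho>:
  assumes "\<forall>z\<in>X. \<forall>w\<in>X. L z w = L z (\<rho> w)" and "z \<in> X" "w \<in> X"
  shows "L z w = L (\<rho> z) (\<rho> w)"
  using assms \<rho>_mem L_hermitian[of z "\<rho> w"] L_hermitian[of "\<rho> z" "\<rho> w"]
  by (metis complex_cnj_cancel_iff)

theorem reducing_iff_L:
  "reducing_subspace M A S1 \<and> reducing_subspace M A S2 \<longleftrightarrow>
    closed_subspace_of S1 M \<and> closed_subspace_of S2 M \<and> (\<forall>z\<in>X. \<forall>w\<in>X. L z w = L z (\<rho> w))"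
proof
  assume red: "reducing_subspace M A S1 \<and> reducing_subspace M A S2"
  then have "L z w = L z (\<rho> w)" if "z \<in> X" "w \<in> X" for z w
    using that by (intro invariant_imp_L) (auto simp: reducing_iff)
  with red show "closed_subspace_of S1 M \<and> closed_subspace_of S2 M \<and>
      (\<forall>z\<in>X. \<forall>w\<in>X. L z w = L z (\<rho> w))"
    by (simp add: reducing_iff)
qed (use L_imp_reducing in blast)

end

section \<open>The Hardy space of the bidisk\<close>

lemma bidisk_iff: "z \<in> bidisk \<longleftrightarrow> cmod (fst z) < 1 \<and> cmod (snd z) < 1"
  by (cases z) (simp add: bidisk_def)

definition monomial :: "nat \<times> nat \<Rightarrow> complex \<times> complex \<Rightarrow> complex" where
  "monomial p z = fst z ^ fst p * snd z ^ snd p"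

lemma power_series2_iff:
  "power_series2 f a \<longleftrightarrow> (\<forall>z\<in>bidisk. ((\<lambda>p. a p * monomial p z) has_sum f z) UNIV)"
  by (simp add: power_series2_def monomial_def case_prod_unfold mult.assoc)

text \<open>Once the lower coefficients vanish, dividing by z^n and letting z tend to 0 isolates the
  nth one. The division requires nonzero z, hence the limit theorem that leaves out the
  centre.\<close>

lemma powser_sums_zero_imp_zero:
  fixes a :: "nat \<Rightarrow> complex"
  assumes "\<And>z. z \<noteq> 0 \<Longrightarrow> cmod z < 1 \<Longrightarrow> (\<lambda>n. a n * z ^ n) sums 0"
  shows "a n = 0"
proof (induction n rule: less_induct)
  case (less n)
  have "(\<lambda>k. a (k + n) * z ^ k) sums 0" if "z \<noteq> 0" "cmod z < 1" for z
  proof -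
    have "(\<lambda>k. a (k + n) * z ^ (k + n)) sums 0"
      using assms[OF that] less by (subst sums_zero_iff_shift) auto
    then have "(\<lambda>k. z ^ n * (a (k + n) * z ^ k)) sums (z ^ n * 0)"
      by (simp add: power_add mult_ac)
    then show ?thesis
      using that by (subst (asm) sums_mult_iff) auto
  qed
  then have "((\<lambda>_. 0) \<longlongrightarrow> a (0 + n)) (at (0::complex))"
    by (intro powser_limit_0_strong[of 1]) auto
  then show "a n = 0"
    by (simp add: tendsto_const_iff)
qed

text \<open>The one-variable result is used twice. For fixed y, summing over n first gives a power
  series in x whose coefficients must vanish; each of these is in turn a power series in y.\<close>

lemma power_series2_zero_imp_zero:
  assumes "power_series2 (\<lambda>_. 0) c"
  shows "c = (\<lambda>_. 0)"
proof
  fix p :: "nat \<times> nat"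
  obtain m n where p: "p = (m, n)" by (cases p)
  have sum0: "((\<lambda>(m, n). c (m, n) * x ^ m * y ^ n) has_sum 0) (UNIV \<times> UNIV)"
    if "cmod x < 1" "cmod y < 1" for x y
    using bspec[OF assms[unfolded power_series2_def], of "(x, y)"] that by (simp add: bidisk_iff)
  \<comment> \<open>Summability of a row is read off at x = 1/2; any nonzero x in the disk would
    allow the factor x^m to be scaled away.\<close>
  have inner: "(\<lambda>n. c (m, n) * y ^ n) summable_on UNIV" if y: "cmod y < 1" for m y
  proof -
    have "(\<lambda>(m, n). c (m, n) * (1/2) ^ m * y ^ n) summable_on (UNIV \<times> UNIV)"
      using sum0[of "1/2" y] y by (auto simp: summable_on_def)
    then have "(\<lambda>n. c (m, n) * (1/2) ^ m * y ^ n) summable_on UNIV"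
      by (rule summable_on_SigmaD1) simp
    then have "(\<lambda>n. 2 ^ m * (c (m, n) * (1/2) ^ m * y ^ n)) summable_on UNIV"
      by (rule summable_on_cmult_right)
    then show ?thesis by (simp add: power_divide)
  qed
  have "(\<Sum>\<^sub>\<infinity>n. c (m, n) * y ^ n) = 0" if y: "cmod y < 1" for m y
  proof (rule powser_sums_zero_imp_zero[of "\<lambda>m. \<Sum>\<^sub>\<infinity>n. c (m, n) * y ^ n"])
    fix x :: complex assume x: "cmod x < 1"
    show "(\<lambda>m. (\<Sum>\<^sub>\<infinity>n. c (m, n) * y ^ n) * x ^ m) sums 0"
    proof (rule has_sum_imp_sums, rule has_sum_SigmaD[OF sum0[OF x y]])
      fix m
      have "((\<lambda>n. c (m, n) * y ^ n * x ^ m) has_sum (\<Sum>\<^sub>\<infinity>n. c (m, n) * y ^ n) * x ^ m) UNIV"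
        by (intro has_sum_cmult_left has_sum_infsum inner y)
      then show "((\<lambda>n. case (m, n) of (m, n) \<Rightarrow> c (m, n) * x ^ m * y ^ n) has_sum
          (\<Sum>\<^sub>\<infinity>n. c (m, n) * y ^ n) * x ^ m) UNIV"
        by (simp add: mult_ac)
    qed
  qed
  then have "(\<lambda>n. c (m, n) * y ^ n) sums 0" if "cmod y < 1" for y
    using has_sum_imp_sums[OF has_sum_infsum[OF inner[OF that]], of m] that by simp
  then show "c p = 0"
    unfolding p by (rule powser_sums_zero_imp_zero)
qed

lemma power_series2_unique:
  assumes "power_series2 f a" "power_series2 f b"
  shows "a = b"
proof -
  have "power_series2 (\<lambda>_. 0) (\<lambda>p. a p - b p)"
    unfolding power_series2_iff
  proof
    fix z :: "complex \<times> complex" assume "z \<in> bidisk"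
    then have "((\<lambda>p. a p * monomial p z + - 1 * (b p * monomial p z)) has_sum f z + - 1 * f z) UNIV"
      using assms unfolding power_series2_iff by (intro has_sum_add has_sum_cmult_right) auto
    then show "((\<lambda>p. (a p - b p) * monomial p z) has_sum 0) UNIV"
      by (simp add: left_diff_distrib)
  qed
  from power_series2_zero_imp_zero[OF this] show ?thesis by (simp add: fun_eq_iff)
qed

lemma coeffs2_eqI: "power_series2 f a \<Longrightarrow> coeffs2 f = a"
  unfolding coeffs2_def using power_series2_unique by blast

section \<open>Square-summable coefficient families\<close>

definition square_summable :: "(nat \<times> nat \<Rightarrow> complex) \<Rightarrow> bool" where
  "square_summable a \<longleftrightarrow> (\<lambda>p. (cmod (a p))\<^sup>2) summable_on UNIV"

lemma square_summable_product:
  assumes "square_summable a" "square_summable b"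
  shows "(\<lambda>p. a p * b p) summable_on UNIV"
  unfolding summable_on_iff_abs_summable_on_complex
  by (rule abs_summable_product) (use assms in \<open>simp_all add: square_summable_def norm_mult power2_eq_square\<close>)

lemma square_summable_cnj: "square_summable (\<lambda>p. cnj (a p)) \<longleftrightarrow> square_summable a"
  by (simp add: square_summable_def)

lemma square_summable_zero: "square_summable (\<lambda>_. 0)"
  by (simp add: square_summable_def)

lemma square_summable_add:
  assumes "square_summable a" "square_summable b"
  shows "square_summable (\<lambda>p. a p + b p)"
  unfolding square_summable_def
proof (rule summable_on_comparison_test)
  show "(\<lambda>p. 2 * (cmod (a p))\<^sup>2 + 2 * (cmod (b p))\<^sup>2) summable_on UNIV"
    using assms unfolding square_summable_def by (intro summable_on_add summable_on_cmult_right)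
  fix p
  have "(cmod (a p + b p))\<^sup>2 \<le> (cmod (a p) + cmod (b p))\<^sup>2"
    by (intro power_mono norm_triangle_ineq) simp
  also have "\<dots> \<le> 2 * (cmod (a p))\<^sup>2 + 2 * (cmod (b p))\<^sup>2"
    using zero_le_power2[of "cmod (a p) - cmod (b p)"] by (simp add: power2_eq_square algebra_simps)
  finally show "(cmod (a p + b p))\<^sup>2 \<le> 2 * (cmod (a p))\<^sup>2 + 2 * (cmod (b p))\<^sup>2" .
qed simp

lemma square_summable_scale:
  assumes "square_summable a"
  shows "square_summable (\<lambda>p. c * a p)"
  using summable_on_cmult_right[of "\<lambda>p. (cmod (a p))\<^sup>2" UNIV "(cmod c)\<^sup>2"] assms
  by (simp add: square_summable_def norm_mult power_mult_distrib)

section \<open>Geometric series and the Szego kernel\<close>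

lemma geometric_has_sum:
  fixes c :: "'a :: {real_normed_field, banach}"
  assumes "norm c < 1"
  shows "((\<lambda>n. c ^ n) has_sum (1 / (1 - c))) UNIV"
proof (rule norm_summable_imp_has_sum[OF _ geometric_sums[OF assms]])
  show "summable (\<lambda>n. norm (c ^ n))"
    using assms by (simp add: norm_power summable_geometric)
qed

lemma double_geometric_has_sum:
  fixes x y :: complex
  assumes x: "cmod x < 1" and y: "cmod y < 1"
  shows "((\<lambda>p. x ^ fst p * y ^ snd p) has_sum (1 / ((1 - x) * (1 - y)))) UNIV"
proof -
  have "((\<lambda>p. x ^ fst p * y ^ snd p) has_sum (1 / (1 - x) * (1 / (1 - y)))) (UNIV \<times> UNIV)"
  proof (rule has_sum_SigmaI)
    show "((\<lambda>n. x ^ fst (m, n) * y ^ snd (m, n)) has_sum x ^ m * (1 / (1 - y))) UNIV" for m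
      using has_sum_cmult_right[OF geometric_has_sum[OF y]] by simp
    show "((\<lambda>m. x ^ m * (1 / (1 - y))) has_sum 1 / (1 - x) * (1 / (1 - y))) UNIV"
      by (rule has_sum_cmult_left[OF geometric_has_sum[OF x]])
    \<comment> \<open>Iterated sums determine the double sum only when the family is summable, which
      is checked on absolute values.\<close>
    have "(\<lambda>p. cmod x ^ fst p * cmod y ^ snd p) summable_on (UNIV \<times> UNIV)"
    proof (rule summable_on_SigmaI)
      show "((\<lambda>n. cmod x ^ fst (m, n) * cmod y ^ snd (m, n)) has_sum cmod x ^ m * (1 / (1 - cmod y))) UNIV" for m
        using has_sum_cmult_right[OF geometric_has_sum[of "cmod y"]] y by simp
      have "((\<lambda>m. cmod x ^ m * (1 / (1 - cmod y))) has_sum 1 / (1 - cmod x) * (1 / (1 - cmod y))) UNIV"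
        by (intro has_sum_cmult_left geometric_has_sum) (simp add: x)
      then show "(\<lambda>m. cmod x ^ m * (1 / (1 - cmod y))) summable_on UNIV"
        by (rule has_sum_imp_summable)
    qed simp
    then show "(\<lambda>p. x ^ fst p * y ^ snd p) summable_on (UNIV \<times> UNIV)"
      unfolding summable_on_iff_abs_summable_on_complex by (simp add: norm_mult norm_power)
  qed
  then show ?thesis by simp
qed

definition szego :: "complex \<times> complex \<Rightarrow> complex \<times> complex \<Rightarrow> complex" where
  "szego z w = 1 / ((1 - fst z * cnj (fst w)) * (1 - snd z * cnj (snd w)))"

lemma szego_has_sum:
  assumes "z \<in> bidisk" "w \<in> bidisk"
  shows "((\<lambda>p. cnj (monomial p w) * monomial p z) has_sum szego z w) UNIV"
proof -
  have "cmod (fst z * cnj (fst w)) < 1" "cmod (snd z * cnj (snd w)) < 1"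
    using assms mult_strict_mono'[of "cmod (fst z)" 1 "cmod (fst w)" 1]
      mult_strict_mono'[of "cmod (snd z)" 1 "cmod (snd w)" 1]
    by (auto simp: bidisk_iff norm_mult)
  from double_geometric_has_sum[OF this] show ?thesis
    by (simp add: szego_def monomial_def power_mult_distrib mult_ac)
qed

lemma monomial_square_summable:
  assumes "z \<in> bidisk"
  shows "square_summable (\<lambda>p. monomial p z)"
proof -
  have "(\<lambda>p. cnj (monomial p z) * monomial p z) summable_on UNIV"
    using szego_has_sum[OF assms assms] by (rule has_sum_imp_summable)
  then show ?thesis
    unfolding summable_on_iff_abs_summable_on_complex
    by (simp add: square_summable_def norm_mult power2_eq_square)
qed

section \<open>The Hardy space through its Taylor coefficients\<close>

definition from_coeffs :: "(nat \<times> nat \<Rightarrow> complex) \<Rightarrow> complex \<times> complex \<Rightarrow> complex" where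
  "from_coeffs a = (\<lambda>z. if z \<in> bidisk then \<Sum>\<^sub>\<infinity>p. a p * monomial p z else 0)"

lemma power_series2_from_coeffs:
  assumes "square_summable a"
  shows "power_series2 (from_coeffs a) a"
  unfolding power_series2_iff from_coeffs_def
  using square_summable_product[OF assms monomial_square_summable] by auto

text \<open>Uniqueness of coefficients lets \<open>coeffs2 f\<close> replace the existential witness
  in the definition.\<close>

lemma hardy2_iff:
  "f \<in> elems hardy2 \<longleftrightarrow>
    (\<forall>z. z \<notin> bidisk \<longrightarrow> f z = 0) \<and> power_series2 f (coeffs2 f) \<and> square_summable (coeffs2 f)"
  unfolding hardy2_def square_summable_def using coeffs2_eqI by auto

lemma hardy2_outside: "f \<in> elems hardy2 \<Longrightarrow> z \<notin> bidisk \<Longrightarrow> f z = 0"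
  unfolding hardy2_iff by blast

lemma hardy2_I:
  assumes "power_series2 f a" "square_summable a" "\<And>z. z \<notin> bidisk \<Longrightarrow> f z = 0"
  shows "f \<in> elems hardy2"
  using assms coeffs2_eqI by (simp add: hardy2_iff)

lemma hardy2_eval:
  "f \<in> elems hardy2 \<Longrightarrow> z \<in> bidisk \<Longrightarrow> ((\<lambda>p. coeffs2 f p * monomial p z) has_sum f z) UNIV"
  by (simp add: hardy2_iff power_series2_iff)

lemma from_coeffs_mem: "square_summable a \<Longrightarrow> from_coeffs a \<in> elems hardy2"
  by (rule hardy2_I[OF power_series2_from_coeffs]) (simp_all add: from_coeffs_def)

lemma coeffs2_from_coeffs: "square_summable a \<Longrightarrow> coeffs2 (from_coeffs a) = a"
  by (rule coeffs2_eqI[OF power_series2_from_coeffs])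

lemma coeffs2_square_summable: "f \<in> elems hardy2 \<Longrightarrow> square_summable (coeffs2 f)"
  by (simp add: hardy2_iff)

lemma hardy2_eqI:
  assumes "f \<in> elems hardy2" "g \<in> elems hardy2" "coeffs2 f = coeffs2 g"
  shows "f = g"
proof
  fix z show "f z = g z"
  proof (cases "z \<in> bidisk")
    case True
    from hardy2_eval[OF assms(1) this] hardy2_eval[OF assms(2) this] show ?thesis
      unfolding assms(3) by (rule has_sum_unique)
  qed (simp add: assms hardy2_outside)
qed

lemma power_series2_add:
  "power_series2 f a \<Longrightarrow> power_series2 g b \<Longrightarrow> power_series2 (\<lambda>z. f z + g z) (\<lambda>p. a p + b p)"
  unfolding power_series2_iff by (simp add: has_sum_add distrib_right)

lemma power_series2_scale:
  "power_series2 f a \<Longrightarrow> power_series2 (\<lambda>z. c * f z) (\<lambda>p. c * a p)"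
  unfolding power_series2_iff by (simp add: has_sum_cmult_right mult.assoc)

lemma coeffs2_add:
  "f \<in> elems hardy2 \<Longrightarrow> g \<in> elems hardy2 \<Longrightarrow> coeffs2 (\<lambda>z. f z + g z) = (\<lambda>p. coeffs2 f p + coeffs2 g p)"
  by (intro coeffs2_eqI power_series2_add) (simp_all add: hardy2_iff)

lemma coeffs2_scale:
  "f \<in> elems hardy2 \<Longrightarrow> coeffs2 (\<lambda>z. c * f z) = (\<lambda>p. c * coeffs2 f p)"
  by (intro coeffs2_eqI power_series2_scale) (simp add: hardy2_iff)

lemma hardy2_add: "f \<in> elems hardy2 \<Longrightarrow> g \<in> elems hardy2 \<Longrightarrow> (\<lambda>z. f z + g z) \<in> elems hardy2"
  using coeffs2_add[of f g] power_series2_add[of f "coeffs2 f" g "coeffs2 g"]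
  by (simp add: hardy2_iff square_summable_add)

lemma hardy2_scale: "f \<in> elems hardy2 \<Longrightarrow> (\<lambda>z. c * f z) \<in> elems hardy2"
  using coeffs2_scale[of f c] power_series2_scale[of f "coeffs2 f" c]
  by (simp add: hardy2_iff square_summable_scale)

lemma power_series2_zero: "power_series2 (\<lambda>_. 0) (\<lambda>_. 0)"
  by (simp add: power_series2_iff)

lemma hardy2_zero: "(\<lambda>_. 0) \<in> elems hardy2"
  by (rule hardy2_I[OF power_series2_zero square_summable_zero]) simp

lemma coeffs2_diff:
  assumes "f \<in> elems hardy2" "g \<in> elems hardy2"
  shows "coeffs2 (\<lambda>z. f z - g z) = (\<lambda>p. coeffs2 f p - coeffs2 g p)"
  using coeffs2_add[OF assms(1) hardy2_scale[OF assms(2)], of "-1"] coeffs2_scale[OF assms(2), of "-1"]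
  by simp

lemma hardy2_diff: "f \<in> elems hardy2 \<Longrightarrow> g \<in> elems hardy2 \<Longrightarrow> (\<lambda>z. f z - g z) \<in> elems hardy2"
  using hardy2_add[of f "\<lambda>z. -1 * g z"] hardy2_scale[of g "-1"] by simp

lemma inprod_hardy2: "inprod hardy2 f g = (\<Sum>\<^sub>\<infinity>p. coeffs2 f p * cnj (coeffs2 g p))"
  by (simp add: hardy2_def)

lemma inprod_hardy2_summable:
  "f \<in> elems hardy2 \<Longrightarrow> g \<in> elems hardy2 \<Longrightarrow> (\<lambda>p. coeffs2 f p * cnj (coeffs2 g p)) summable_on UNIV"
  by (rule square_summable_product) (simp_all add: square_summable_cnj coeffs2_square_summable)

lemma inprod_hardy2_self:
  assumes "f \<in> elems hardy2"
  shows "inprod hardy2 f f = of_real (\<Sum>\<^sub>\<infinity>p. (cmod (coeffs2 f p))\<^sup>2)"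
  unfolding inprod_hardy2 complex_norm_square[symmetric]
  using coeffs2_square_summable[OF assms] unfolding square_summable_def
  by (intro infsumI has_sum_of_real has_sum_infsum)

lemma hnorm_hardy2:
  assumes "f \<in> elems hardy2"
  shows "hnorm hardy2 f = sqrt (\<Sum>\<^sub>\<infinity>p. (cmod (coeffs2 f p))\<^sup>2)"
  unfolding hnorm_def inprod_hardy2_self[OF assms] by simp

lemma hnorm_hardy2_sq:
  assumes "f \<in> elems hardy2"
  shows "(hnorm hardy2 f)\<^sup>2 = (\<Sum>\<^sub>\<infinity>p. (cmod (coeffs2 f p))\<^sup>2)"
  unfolding hnorm_hardy2[OF assms] by (simp add: infsum_nonneg)

text \<open>The usual completeness proof for square-summable families, carried out on coefficients:
  these converge pointwise, and the Cauchy bounds survive the limit on finite index sets and then on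
  the whole index set.\<close>

lemma hardy2_complete:
  assumes F: "\<And>n. F n \<in> elems hardy2"
    and cauchy: "\<And>e. e > 0 \<Longrightarrow> \<exists>N::nat. \<forall>m\<ge>N. \<forall>n\<ge>N. hnorm hardy2 (\<lambda>z. F m z - F n z) < e"
  shows "\<exists>f\<in>elems hardy2. (\<lambda>n. hnorm hardy2 (\<lambda>z. F n z - f z)) \<longlonglongrightarrow> 0"
proof -
  define a where "a n = coeffs2 (F n)" for n
  have partial: "(\<Sum>p\<in>S. (cmod (a m p - a n p))\<^sup>2) \<le> (hnorm hardy2 (\<lambda>z. F m z - F n z))\<^sup>2"
    if "finite S" for S m n
    unfolding hnorm_hardy2_sq[OF hardy2_diff[OF F F]] coeffs2_diff[OF F F] a_def
    using coeffs2_square_summable[OF hardy2_diff[OF F F]] that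
    unfolding square_summable_def coeffs2_diff[OF F F]
    by (intro finite_sum_le_infsum) auto
  have hnorm_nonneg: "hnorm hardy2 (\<lambda>z. F m z - F n z) \<ge> 0" for m n
    unfolding hnorm_hardy2[OF hardy2_diff[OF F F]] by (simp add: infsum_nonneg)
  have "Cauchy (\<lambda>n. a n p)" for p
  proof (rule CauchyI)
    fix e :: real assume "e > 0"
    then obtain N where N: "\<And>m n. m \<ge> N \<Longrightarrow> n \<ge> N \<Longrightarrow> hnorm hardy2 (\<lambda>z. F m z - F n z) < e"
      using cauchy by blast
    have "cmod (a m p - a n p) < e" if "m \<ge> N" "n \<ge> N" for m n
    proof -
      have "(cmod (a m p - a n p))\<^sup>2 \<le> (hnorm hardy2 (\<lambda>z. F m z - F n z))\<^sup>2"
        using partial[of "{p}" m n] by simp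
      then have "cmod (a m p - a n p) \<le> hnorm hardy2 (\<lambda>z. F m z - F n z)"
        by (rule power2_le_imp_le) (rule hnorm_nonneg)
      with N[OF that] show ?thesis by simp
    qed
    then show "\<exists>M. \<forall>m\<ge>M. \<forall>n\<ge>M. norm (a m p - a n p) < e" by blast
  qed
  then have "\<forall>p. \<exists>l. (\<lambda>n. a n p) \<longlonglongrightarrow> l"
    using Cauchy_convergent convergent_def by blast
  then obtain b where b: "\<And>p. (\<lambda>n. a n p) \<longlonglongrightarrow> b p"
    using choice[of "\<lambda>p l. (\<lambda>n. a n p) \<longlonglongrightarrow> l"] by blast
  \<comment> \<open>With \<open>m\<close> and the finite set \<open>S\<close> fixed, n tends to
    infinity in the Cauchy bound; the threshold does not depend on \<open>S\<close>.\<close>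
  have limit: "\<exists>N. \<forall>m\<ge>N. \<forall>S. finite S \<longrightarrow> (\<Sum>p\<in>S. (cmod (a m p - b p))\<^sup>2) \<le> e\<^sup>2" if e: "e > 0" for e
  proof -
    obtain N where N: "\<And>m n. m \<ge> N \<Longrightarrow> n \<ge> N \<Longrightarrow> hnorm hardy2 (\<lambda>z. F m z - F n z) < e"
      using cauchy[OF e] by blast
    have "(\<Sum>p\<in>S. (cmod (a m p - b p))\<^sup>2) \<le> e\<^sup>2" if "m \<ge> N" "finite S" for m S
    proof (rule tendsto_upperbound)
      show "(\<lambda>n. \<Sum>p\<in>S. (cmod (a m p - a n p))\<^sup>2) \<longlonglongrightarrow> (\<Sum>p\<in>S. (cmod (a m p - b p))\<^sup>2)"
        by (intro tendsto_sum tendsto_power tendsto_norm tendsto_diff tendsto_const b)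
      show "\<forall>\<^sub>F n in sequentially. (\<Sum>p\<in>S. (cmod (a m p - a n p))\<^sup>2) \<le> e\<^sup>2"
        using eventually_ge_at_top[of N]
      proof eventually_elim
        case (elim n)
        have "(hnorm hardy2 (\<lambda>z. F m z - F n z))\<^sup>2 \<le> e\<^sup>2"
          using N[OF \<open>m \<ge> N\<close> elim] hnorm_nonneg by (intro power_mono) auto
        with partial[OF \<open>finite S\<close>, of m n] show ?case by simp
      qed
    qed simp
    then show ?thesis by blast
  qed
  have diff_l2: "\<exists>N. \<forall>m\<ge>N. square_summable (\<lambda>p. a m p - b p) \<and> (\<Sum>\<^sub>\<infinity>p. (cmod (a m p - b p))\<^sup>2) \<le> e\<^sup>2"
    if e: "e > 0" for e
  proof -
    obtain N where N: "\<And>m S. m \<ge> N \<Longrightarrow> finite S \<Longrightarrow> (\<Sum>p\<in>S. (cmod (a m p - b p))\<^sup>2) \<le> e\<^sup>2"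
      using limit[OF e] by blast
    have "square_summable (\<lambda>p. a m p - b p) \<and> (\<Sum>\<^sub>\<infinity>p. (cmod (a m p - b p))\<^sup>2) \<le> e\<^sup>2" if "m \<ge> N" for m
    proof
      have "bdd_above (sum (\<lambda>p. (cmod (a m p - b p))\<^sup>2) ` {S. S \<subseteq> UNIV \<and> finite S})"
        using N[OF that] by (intro bdd_aboveI2) auto
      then show l2: "square_summable (\<lambda>p. a m p - b p)"
        unfolding square_summable_def by (intro nonneg_bdd_above_summable_on) auto
      show "(\<Sum>\<^sub>\<infinity>p. (cmod (a m p - b p))\<^sup>2) \<le> e\<^sup>2"
        using l2 N[OF that] unfolding square_summable_def by (intro infsum_le_finite_sums) auto
    qed
    then show ?thesis by blast
  qed
  obtain N where "square_summable (\<lambda>p. a N p - b p)"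
    using diff_l2[of 1] by auto
  \<comment> \<open>The limit family is written as a N - (a N - b), a difference of two
    square-summable families.\<close>
  then have "square_summable (\<lambda>p. a N p + - 1 * (a N p - b p))"
    using coeffs2_square_summable[OF F] unfolding a_def
    by (intro square_summable_add square_summable_scale)
  then have b_l2: "square_summable b" by simp
  define f where "f = from_coeffs b"
  have f: "f \<in> elems hardy2" and f_coeffs: "coeffs2 f = b"
    using b_l2 by (simp_all add: f_def from_coeffs_mem coeffs2_from_coeffs)
  have norm_eq: "(hnorm hardy2 (\<lambda>z. F n z - f z))\<^sup>2 = (\<Sum>\<^sub>\<infinity>p. (cmod (a n p - b p))\<^sup>2)" for n
    unfolding hnorm_hardy2_sq[OF hardy2_diff[OF F f]] coeffs2_diff[OF F f] f_coeffs a_def by (rule refl)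
  have "(\<lambda>n. hnorm hardy2 (\<lambda>z. F n z - f z)) \<longlonglongrightarrow> 0"
  proof (rule LIMSEQ_I)
    fix e :: real assume e: "e > 0"
    then obtain N where N: "\<And>m. m \<ge> N \<Longrightarrow> (\<Sum>\<^sub>\<infinity>p. (cmod (a m p - b p))\<^sup>2) \<le> (e / 2)\<^sup>2"
      using diff_l2[of "e / 2"] by auto
    have "norm (hnorm hardy2 (\<lambda>z. F m z - f z) - 0) < e" if "m \<ge> N" for m
    proof -
      have "\<bar>hnorm hardy2 (\<lambda>z. F m z - f z)\<bar> \<le> e / 2"
        using N[OF that] e unfolding norm_eq[symmetric] by (simp add: abs_le_square_iff[symmetric])
      with e show ?thesis by simp
    qed
    then show "\<exists>N. \<forall>m\<ge>N. norm (hnorm hardy2 (\<lambda>z. F m z - f z) - 0) < e" by blast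
  qed
  with f show ?thesis by blast
qed

lemma szego_section:
  assumes "w \<in> bidisk"
  shows "power_series2 (kernel_section bidisk szego w) (\<lambda>p. cnj (monomial p w))"
  using szego_has_sum[OF _ assms] by (simp add: power_series2_iff kernel_section_def)

lemma hardy2_rkhs: "rkhs bidisk hardy2 szego"
proof
  show "f x = 0" if "f \<in> elems hardy2" "x \<notin> bidisk" for f x
    using that by (rule hardy2_outside)
  show "linear_subspace (elems hardy2)"
    by (simp add: linear_subspace_def hardy2_zero hardy2_add hardy2_scale)
  show "inprod hardy2 (\<lambda>x. f x + g x) h = inprod hardy2 f h + inprod hardy2 g h"
    if "f \<in> elems hardy2" "g \<in> elems hardy2" "h \<in> elems hardy2" for f g h
    unfolding inprod_hardy2 coeffs2_add[OF that(1,2)] distrib_right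
    by (intro infsum_add inprod_hardy2_summable that)
  show "inprod hardy2 (\<lambda>x. c * f x) g = c * inprod hardy2 f g"
    if "f \<in> elems hardy2" "g \<in> elems hardy2" for f g c
    unfolding inprod_hardy2 coeffs2_scale[OF that(1)] mult.assoc by (rule infsum_cmult_right')
  show "inprod hardy2 g f = cnj (inprod hardy2 f g)" for f g
    unfolding inprod_hardy2 infsum_cnj[symmetric] by (simp add: mult.commute)
  show "inprod hardy2 f f \<in> \<real>\<^sub>\<ge>\<^sub>0" if "f \<in> elems hardy2" for f
    unfolding inprod_hardy2_self[OF that] by (simp add: infsum_nonneg)
  show "f = (\<lambda>_. 0)" if f: "f \<in> elems hardy2" and 0: "inprod hardy2 f f = 0" for f
  proof -
    have "(\<Sum>\<^sub>\<infinity>p. (cmod (coeffs2 f p))\<^sup>2) = 0"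
      using 0 unfolding inprod_hardy2_self[OF f] by simp
    then have "(cmod (coeffs2 f p))\<^sup>2 = 0" for p
      using nonneg_infsum_le_0D[of "\<lambda>p. (cmod (coeffs2 f p))\<^sup>2" UNIV p] coeffs2_square_summable[OF f]
      by (simp add: square_summable_def)
    then have "coeffs2 f = coeffs2 (\<lambda>_. 0)"
      by (simp add: fun_eq_iff coeffs2_eqI[OF power_series2_zero])
    then show ?thesis by (rule hardy2_eqI[OF f hardy2_zero])
  qed
  show "\<exists>f\<in>elems hardy2. (\<lambda>n. hnorm hardy2 (\<lambda>x. F n x - f x)) \<longlonglongrightarrow> 0"
    if "\<And>n. F n \<in> elems hardy2"
      "\<And>e. e > 0 \<Longrightarrow> \<exists>N. \<forall>m\<ge>N. \<forall>n\<ge>N. hnorm hardy2 (\<lambda>x. F m x - F n x) < e" for F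
    using that by (rule hardy2_complete)
  show "kernel_section bidisk szego w \<in> elems hardy2" if "w \<in> bidisk" for w
    by (rule hardy2_I[OF szego_section[OF that]])
      (simp_all add: square_summable_cnj monomial_square_summable that kernel_section_def)
  show "f w = inprod hardy2 f (kernel_section bidisk szego w)"
    if "f \<in> elems hardy2" "w \<in> bidisk" for f w
    using hardy2_eval[OF that]
    unfolding inprod_hardy2 coeffs2_eqI[OF szego_section[OF that(2)]] complex_cnj_cnj
    by (simp add: infsumI)
qed

section \<open>Multiplication by a variable and its backward shift\<close>

locale monomial_shift =
  fixes \<sigma> :: "nat \<times> nat \<Rightarrow> nat \<times> nat" and \<zeta> :: "complex \<times> complex \<Rightarrow> complex"
    and \<rho> :: "complex \<times> complex \<Rightarrow> complex \<times> complex"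
  assumes inj: "inj \<sigma>"
    and \<rho>_mem: "z \<in> bidisk \<Longrightarrow> \<rho> z \<in> bidisk"
    and \<zeta>_\<rho>: "\<zeta> (\<rho> z) = 0"
    and \<zeta>_less_1: "z \<in> bidisk \<Longrightarrow> cmod (\<zeta> z) < 1"
    and monomial_\<sigma>: "monomial (\<sigma> p) z = \<zeta> z * monomial p z"
    and monomial_\<rho>: "p \<notin> range \<sigma> \<Longrightarrow> monomial p (\<rho> z) = monomial p z"
begin

text \<open>The forward shift of coefficients, belonging to multiplication by \<zeta>. Indices
  outside \<open>range \<sigma>\<close> get 0, being those of the monomials without a factor
  \<zeta>.\<close>

definition up :: "(nat \<times> nat \<Rightarrow> complex) \<Rightarrow> nat \<times> nat \<Rightarrow> complex" where
  "up a p = (if p \<in> range \<sigma> then a (inv \<sigma> p) else 0)"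

definition backward :: "(complex \<times> complex \<Rightarrow> complex) \<Rightarrow> complex \<times> complex \<Rightarrow> complex" where
  "backward f = from_coeffs (coeffs2 f \<circ> \<sigma>)"

lemma up_\<sigma> [simp]: "up a (\<sigma> p) = a p"
  by (simp add: up_def inj)

lemma has_sum_range_\<sigma>:
  fixes S :: "'a :: topological_comm_monoid_add"
  assumes "\<And>p. p \<notin> range \<sigma> \<Longrightarrow> g p = 0"
  shows "(g has_sum S) UNIV \<longleftrightarrow> ((\<lambda>p. g (\<sigma> p)) has_sum S) UNIV"
proof -
  have "(g has_sum S) UNIV \<longleftrightarrow> (g has_sum S) (range \<sigma>)"
    using assms by (intro has_sum_cong_neutral) auto
  also have "\<dots> \<longleftrightarrow> ((\<lambda>p. g (\<sigma> p)) has_sum S) UNIV"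
    using has_sum_reindex[OF inj] by (simp add: comp_def)
  finally show ?thesis .
qed

lemma power_series2_up:
  assumes "power_series2 f a"
  shows "power_series2 (\<lambda>z. \<zeta> z * f z) (up a)"
  unfolding power_series2_iff
proof
  fix z :: "complex \<times> complex" assume "z \<in> bidisk"
  then have "((\<lambda>p. \<zeta> z * (a p * monomial p z)) has_sum \<zeta> z * f z) UNIV"
    using assms unfolding power_series2_iff by (intro has_sum_cmult_right) blast
  then show "((\<lambda>p. up a p * monomial p z) has_sum \<zeta> z * f z) UNIV"
    by (subst has_sum_range_\<sigma>) (simp_all add: up_def[of a "_ :: nat \<times> nat"] monomial_\<sigma> mult.left_commute inj)
qed

lemma square_summable_up:
  assumes "square_summable a"
  shows "square_summable (up a)"
proof -
  have "((\<lambda>p. (cmod (up a p))\<^sup>2) has_sum (\<Sum>\<^sub>\<infinity>p. (cmod (a p))\<^sup>2)) UNIV"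
    by (subst has_sum_range_\<sigma>) (use assms in \<open>simp_all add: up_def inj square_summable_def\<close>)
  then show ?thesis unfolding square_summable_def by (rule has_sum_imp_summable)
qed

lemma square_summable_\<sigma>:
  assumes "square_summable a"
  shows "square_summable (a \<circ> \<sigma>)"
proof -
  have "(\<lambda>p. (cmod (a p))\<^sup>2) summable_on range \<sigma>"
    using assms unfolding square_summable_def by (rule summable_on_subset) simp
  then show ?thesis
    unfolding square_summable_def summable_on_reindex[OF inj] by (simp add: comp_def)
qed

lemma coeffs2_shift:
  "f \<in> elems hardy2 \<Longrightarrow> coeffs2 (\<lambda>z. \<zeta> z * f z) = up (coeffs2 f)"
  by (intro coeffs2_eqI power_series2_up) (simp add: hardy2_iff)

lemma coeffs2_backward:
  "f \<in> elems hardy2 \<Longrightarrow> coeffs2 (backward f) = coeffs2 f \<circ> \<sigma>"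
  unfolding backward_def by (intro coeffs2_from_coeffs square_summable_\<sigma> coeffs2_square_summable)

lemma shift_mem:
  assumes "f \<in> elems hardy2"
  shows "(\<lambda>z. \<zeta> z * f z) \<in> elems hardy2"
proof (rule hardy2_I)
  show "power_series2 (\<lambda>z. \<zeta> z * f z) (up (coeffs2 f))"
    using assms by (intro power_series2_up) (simp add: hardy2_iff)
qed (use assms hardy2_outside in \<open>auto intro: square_summable_up coeffs2_square_summable\<close>)

lemma backward_mem: "f \<in> elems hardy2 \<Longrightarrow> backward f \<in> elems hardy2"
  unfolding backward_def by (intro from_coeffs_mem square_summable_\<sigma> coeffs2_square_summable)

text \<open>The Taylor series of \<open>f\<close> is split along \<open>range \<sigma>\<close>. The
  terms inside carry a factor \<zeta> and sum to \<zeta> times the backward shift; those outside are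
  unchanged by \<rho> and sum to f (\<rho> z), since \<rho> kills the others.\<close>

lemma backward_eval:
  assumes f: "f \<in> elems hardy2" and z: "z \<in> bidisk"
  shows "\<zeta> z * backward f z = f z - f (\<rho> z)"
proof -
  let ?c = "coeffs2 f"
  have "((\<lambda>p. \<zeta> z * (?c (\<sigma> p) * monomial p z)) has_sum \<zeta> z * backward f z) UNIV"
    using hardy2_eval[OF backward_mem[OF f] z] coeffs2_backward[OF f]
    by (intro has_sum_cmult_right) simp
  then have "(((\<lambda>p. ?c p * monomial p z) \<circ> \<sigma>) has_sum \<zeta> z * backward f z) UNIV"
    by (simp add: comp_def monomial_\<sigma> mult.left_commute)
  then have 1: "((\<lambda>p. ?c p * monomial p z) has_sum \<zeta> z * backward f z) (range \<sigma>)"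
    by (simp add: has_sum_reindex[OF inj])
  have "((\<lambda>p. ?c p * monomial p (\<rho> z)) has_sum f (\<rho> z)) UNIV \<longleftrightarrow>
      ((\<lambda>p. ?c p * monomial p z) has_sum f (\<rho> z)) (- range \<sigma>)"
    by (rule has_sum_cong_neutral) (auto simp: monomial_\<sigma> \<zeta>_\<rho> monomial_\<rho>)
  with hardy2_eval[OF f \<rho>_mem[OF z]]
  have "((\<lambda>p. ?c p * monomial p z) has_sum f (\<rho> z)) (- range \<sigma>)"
    by simp
  from has_sum_Un_disjoint[OF 1 this]
  have "((\<lambda>p. ?c p * monomial p z) has_sum (\<zeta> z * backward f z + f (\<rho> z))) UNIV"
    by simp
  from has_sum_unique[OF this hardy2_eval[OF f z]] show ?thesis
    by (simp add: algebra_simps)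
qed

text \<open>Both inner products are the same sum over \<open>range \<sigma>\<close>, reindexed by
  \<sigma>.\<close>

lemma shift_adjoint:
  assumes f: "f \<in> elems hardy2" and h: "h \<in> elems hardy2"
  shows "inprod hardy2 (\<lambda>z. \<zeta> z * f z) h = inprod hardy2 f (backward h)"
proof -
  have "((\<lambda>p. coeffs2 f p * cnj (coeffs2 (backward h) p)) has_sum inprod hardy2 f (backward h)) UNIV"
    unfolding inprod_hardy2 using f h by (intro has_sum_infsum inprod_hardy2_summable backward_mem)
  then have "((\<lambda>p. up (coeffs2 f) p * cnj (coeffs2 h p)) has_sum inprod hardy2 f (backward h)) UNIV"
    unfolding coeffs2_backward[OF h] by (subst has_sum_range_\<sigma>) (simp_all add: up_def inj)
  then show ?thesis
    unfolding inprod_hardy2[of "\<lambda>z. \<zeta> z * f z"] coeffs2_shift[OF f] by (rule infsumI)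
qed

lemma backward_shift:
  assumes "f \<in> elems hardy2"
  shows "backward (\<lambda>z. \<zeta> z * f z) = f"
  using assms by (intro hardy2_eqI)
    (simp_all add: backward_mem shift_mem coeffs2_backward coeffs2_shift comp_def)

lemma backward_shift_hardy2: "backward_shift bidisk hardy2 szego \<zeta> \<rho> backward"
  by (intro backward_shift.intro hardy2_rkhs backward_shift_axioms.intro \<rho>_mem \<zeta>_\<rho> \<zeta>_less_1
      shift_mem backward_mem backward_eval shift_adjoint backward_shift)

end

interpretation fst: monomial_shift "\<lambda>(m, n). (Suc m, n)" fst "\<lambda>(x, y). (0, y)"
proof
  show "inj (\<lambda>(m, n). (Suc m, n :: nat))" by (auto simp: inj_on_def)
  fix p :: "nat \<times> nat" and z :: "complex \<times> complex"
  show "monomial p ((\<lambda>(x, y). (0, y)) z) = monomial p z" if "p \<notin> range (\<lambda>(m, n). (Suc m, n))"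
  proof -
    have "fst p = 0" using that by (cases p; cases "fst p") force+
    then show ?thesis by (simp add: monomial_def case_prod_unfold)
  qed
qed (auto simp: bidisk_iff monomial_def)

interpretation snd: monomial_shift "\<lambda>(m, n). (m, Suc n)" snd "\<lambda>(x, y). (x, 0)"
proof
  show "inj (\<lambda>(m :: nat, n). (m, Suc n))" by (auto simp: inj_on_def)
  fix p :: "nat \<times> nat" and z :: "complex \<times> complex"
  show "monomial p ((\<lambda>(x, y). (x, 0)) z) = monomial p z" if "p \<notin> range (\<lambda>(m, n). (m, Suc n))"
  proof -
    have "snd p = 0" using that by (cases p; cases "snd p") force+
    then show ?thesis by (simp add: monomial_def case_prod_unfold)
  qed
qed (auto simp: bidisk_iff monomial_def)

text \<open>Dividing the Agler identity by both factors cancels the one standing before each kernel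
  and leaves the other as denominator; this undoes the crossed indices.\<close>

lemma szego_split:
  assumes "z \<in> bidisk" "w \<in> bidisk"
    and "1 - c = (1 - fst z * cnj (fst w)) * k2 + (1 - snd z * cnj (snd w)) * k1"
  shows "(1 - c) * szego z w = k1 / (1 - fst z * cnj (fst w)) + k2 / (1 - snd z * cnj (snd w))"
proof -
  have "1 - fst z * cnj (fst w) \<noteq> 0" "1 - snd z * cnj (snd w) \<noteq> 0"
    using assms(1,2) by (simp_all only: bidisk_iff one_minus_nonzero not_False_eq_True)
  then show ?thesis
    unfolding assms(3) szego_def by (simp add: field_simps)
qed

section \<open>Reducing Agler subspaces\<close>

theorem theorem4p1:
  fixes \<theta> :: "complex \<times> complex \<Rightarrow> complex"
    and K1 K2 :: "complex \<times> complex \<Rightarrow> complex \<times> complex \<Rightarrow> complex"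
    and S1 S2 :: "(complex \<times> complex) fun_space"
  assumes "inner_function \<theta>"
    and "agler_kernels \<theta> K1 K2"
    and "rkhs bidisk S1 (\<lambda>z w. K1 z w / (1 - fst z * cnj (fst w)))"
    and "rkhs bidisk S2 (\<lambda>z w. K2 z w / (1 - snd z * cnj (snd w)))"
  shows
    "(reducing_subspace (model_space \<theta>) (compression \<theta> fst) S1 \<and>
      reducing_subspace (model_space \<theta>) (compression \<theta> fst) S2
        \<longleftrightarrow>
      closed_subspace_of S1 (model_space \<theta>) \<and> closed_subspace_of S2 (model_space \<theta>) \<and>
      (\<exists>g. \<forall>z\<in>bidisk. \<forall>w\<in>bidisk. K1 z w = g (snd z) (cnj (snd w))))
     \<and>
     (reducing_subspace (model_space \<theta>) (compression \<theta> snd) S1 \<and>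
      reducing_subspace (model_space \<theta>) (compression \<theta> snd) S2
        \<longleftrightarrow>
      closed_subspace_of S1 (model_space \<theta>) \<and> closed_subspace_of S2 (model_space \<theta>) \<and>
      (\<exists>g. \<forall>z\<in>bidisk. \<forall>w\<in>bidisk. K2 z w = g (fst z) (cnj (fst w))))"
proof -
  let ?k1 = "\<lambda>z w. K1 z w / (1 - fst z * cnj (fst w))"
  let ?k2 = "\<lambda>z w. K2 z w / (1 - snd z * cnj (snd w))"
  have positive: "positive_kernel bidisk K1" "positive_kernel bidisk K2"
    using assms(2) by (simp_all add: agler_kernels_def)
  have split: "(1 - \<theta> z * cnj (\<theta> w)) * szego z w = ?k1 z w + ?k2 z w"
    if "z \<in> bidisk" "w \<in> bidisk" for z w
    using assms(2) that unfolding agler_kernels_def by (intro szego_split) auto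
  interpret A1: agler_pair bidisk hardy2 szego fst "\<lambda>(x, y). (0, y)" fst.backward S1 S2 ?k1 ?k2 \<theta> K1
    by (intro agler_pair.intro agler_pair_axioms.intro fst.backward_shift_hardy2 assms(3,4)
        split positive refl)
  \<comment> \<open>The second statement exchanges the variables together with the subspaces and
    kernels, so the two summands of \<open>split\<close> are commuted.\<close>
  interpret A2: agler_pair bidisk hardy2 szego snd "\<lambda>(x, y). (x, 0)" snd.backward S2 S1 ?k2 ?k1 \<theta> K2
    by (intro agler_pair.intro agler_pair_axioms.intro snd.backward_shift_hardy2 assms(3,4)
        split[THEN trans, OF _ _ add.commute] positive refl)
  have M: "A1.M = model_space \<theta>" "A2.M = model_space \<theta>"
    by (simp_all add: A1.M_def A1.V_def A2.M_def A2.V_def model_space_def)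
  have A: "A1.A = compression \<theta> fst" "A2.A = compression \<theta> snd"
    by (simp_all add: fun_eq_iff A1.A_def A2.A_def compression_def M)
  have K1_iff: "(\<forall>z\<in>bidisk. \<forall>w\<in>bidisk. K1 z w = K1 z (case w of (x, y) \<Rightarrow> (0, y))) \<longleftrightarrow>
      (\<exists>g. \<forall>z\<in>bidisk. \<forall>w\<in>bidisk. K1 z w = g (snd z) (cnj (snd w)))" (is "?l \<longleftrightarrow> _")
  proof
    assume ?l
    then have "K1 z w = K1 (0, snd z) (0, snd w)" if "z \<in> bidisk" "w \<in> bidisk" for z w
      using A1.L_depends_on_\<rho>[of z w] that by (simp add: case_prod_unfold)
    then show "\<exists>g. \<forall>z\<in>bidisk. \<forall>w\<in>bidisk. K1 z w = g (snd z) (cnj (snd w))"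
      \<comment> \<open>The witness evaluates \<open>K1\<close> with both first coordinates 0; the
        \<open>cnj\<close> undoes the conjugation in its second argument.\<close>
      by (intro exI[of _ "\<lambda>a b. K1 (0, a) (0, cnj b)"]) simp
  next
    assume "\<exists>g. \<forall>z\<in>bidisk. \<forall>w\<in>bidisk. K1 z w = g (snd z) (cnj (snd w))"
    then show ?l by (auto simp: bidisk_iff)
  qed
  have K2_iff: "(\<forall>z\<in>bidisk. \<forall>w\<in>bidisk. K2 z w = K2 z (case w of (x, y) \<Rightarrow> (x, 0))) \<longleftrightarrow>
      (\<exists>g. \<forall>z\<in>bidisk. \<forall>w\<in>bidisk. K2 z w = g (fst z) (cnj (fst w)))" (is "?l \<longleftrightarrow> _")
  proof
    assume ?l
    then have "K2 z w = K2 (fst z, 0) (fst w, 0)" if "z \<in> bidisk" "w \<in> bidisk" for z w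
      using A2.L_depends_on_\<rho>[of z w] that by (simp add: case_prod_unfold)
    then show "\<exists>g. \<forall>z\<in>bidisk. \<forall>w\<in>bidisk. K2 z w = g (fst z) (cnj (fst w))"
      by (intro exI[of _ "\<lambda>a b. K2 (a, 0) (cnj b, 0)"]) simp
  next
    assume "\<exists>g. \<forall>z\<in>bidisk. \<forall>w\<in>bidisk. K2 z w = g (fst z) (cnj (fst w))"
    then show ?l by (auto simp: bidisk_iff)
  qed
  show ?thesis
    using A1.reducing_iff_L A2.reducing_iff_L unfolding M A K1_iff K2_iff by blast
qed

end
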